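(* Let $\theta^*\in\Theta$ and let $Y=(Y_t)_{t\in\mathbb{Z}}$ be a time series with values in $\{0,1,2,\dots\}$ such that, with $\mathcal{F}_t=\sigma(Y_s,\ s\le t)$ and $k^*=0$, $$Y_t\mid\mathcal{F}_{t-1}\sim\mathrm{Poisson}(\lambda_t),\qquad \lambda_t=E(Y_t\mid\mathcal{F}_{t-1})=f_{\theta^*}(Y_{t-1},Y_{t-2},\dots)\qquad\text{for all } t>k^*$$ (the structure of $(Y_t)_{t\le k^*}$ being otherwise unknown, so that $Y$ may be nonstationary). Assume that $\theta^*$ belongs to the interior of $\Theta$, that $D(\Theta)$, $\mathrm{Id}(\Theta)$ and $A_0(\Theta)$ hold, the sequence $(\alpha_j^{(0)})$ in $A_0(\Theta)$ satisfying $$\alpha_j^{(0)}=O(j^{-\gamma})\quad\text{for some }\gamma>3/2,$$ and that for every $r\ge1$ there exists $C_{r,0}>0$ with $E(Y_t^r)\le C_{r,0}$ for all $t\le k^*$. Then the maximum likelihood estimator $\widehat\theta(T_{1,n})$ computed on $Y_1,\dots,Y_n$ satisfies $$\widehat\theta(T_{1,n})\longrightarrow\theta^*\quad\text{almost surely as } n\to\infty.$$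
   Context: $\Theta\subset\mathbb{R}^d$ is a compact set, and $(f_\theta)_{\theta\in\Theta}$ is a family of measurable non-negative functions $f_\theta:(\mathbb{R}^+)^{\mathbb{N}}\to[0,\infty)$, with $\mathbb{N}=\{1,2,\dots\}$, such that $\theta\mapsto f_\theta$ is twice continuously differentiable on $\Theta$. For a function $g$ on $\Theta$, $\|g\|_\Theta=\sup_{\theta\in\Theta}\|g(\theta)\|$, where $\|\cdot\|$ is the sum of absolute values of the coordinates. Assumption $A_0(\Theta)$: $\|f_\theta(0)\|_\Theta<\infty$ and there is a sequence of non-negative reals $(\alpha^{(0)}_k)_{k\ge1}$ with $\sum_{k\ge1}\alpha^{(0)}_k<1$ such that $\|f_\theta(y)-f_\theta(y')\|_\Theta\le\sum_{k\ge1}\alpha^{(0)}_k|y_k-y'_k|$ for all $y,y'\in(\mathbb{R}^+)^{\mathbb{N}}$. Assumption $D(\Theta)$: there is $\underline{c}>0$ such that $\inf_{\theta\in\Theta}f_\theta(y)\ge\underline{c}$ for all $y\in(\mathbb{R}^+)^{\mathbb{N}}$. Assumption $\mathrm{Id}(\Theta)$: for all $(\theta,\theta')\in\Theta^2$, if $f_\theta(Y_{t-1},Y_{t-2},\dots)=f_{\theta'}(Y_{t-1},Y_{t-2},\dots)$ a.s. for some $t>k^*$, then $\theta=\theta'$. Estimator: for $k\le k'$, $T_{k,k'}=\{k,k+1,\dots,k'\}$. For $T\subset\{1,2,\dots\}$ finite, $\widehat L_n(T,\theta)=\sum_{t\in T}\big(Y_t\log\widehat\lambda_t(\theta)-\widehat\lambda_t(\theta)\big)$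 with $\widehat\lambda_t(\theta)=f_\theta(Y_{t-1},\dots,Y_1,0,0,\dots)$, and $\widehat\theta(T)=\operatorname{argmax}_{\theta\in\Theta}\widehat L_n(T,\theta)$ (a maximizer). *)

theory Defs
  imports "HOL-Probability.Probability"
begin

text \<open>
  \<open>seq_space\<close> is the space of sequences \<open>(y\<^sub>k)\<close>, \<open>k = 1, 2, \<dots>\<close>, of non-negative reals with its
  product sigma-algebra. Its points are the extensional functions on \<open>{1..}\<close>, i.e.
  \<open>undefined\<close> at the unused index \<open>0\<close>.
\<close>

definition seq_space :: "(nat \<Rightarrow> real) measure" where
  "seq_space = PiM {1..} (\<lambda>_. restrict_space borel {0..})"

definition zero_seq :: "nat \<Rightarrow> real" where
  "zero_seq = (\<lambda>k\<in>{1..}. 0)"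

definition l1_norm :: "'b::euclidean_space \<Rightarrow> real" where
  "l1_norm x = (\<Sum>b\<in>Basis. \<bar>x \<bullet> b\<bar>)"

text \<open>The supremum is taken in the extended non-negative reals, so that it may be infinite.\<close>

definition sup_norm :: "'a set \<Rightarrow> ('a \<Rightarrow> 'b::euclidean_space) \<Rightarrow> ennreal" where
  "sup_norm \<Theta> g = (SUP \<theta>\<in>\<Theta>. ennreal (l1_norm (g \<theta>)))"

text \<open>
  Since \<open>S\<close> need not be open (it will be compact), derivatives at the points of \<open>S\<close>
  are taken within \<open>S\<close>.
\<close>

definition C2_on :: "('a::euclidean_space \<Rightarrow> real) \<Rightarrow> 'a set \<Rightarrow> bool" where
  "C2_on g S \<longleftrightarrow>
    (\<exists>(g' :: 'a \<Rightarrow> 'a \<Rightarrow>\<^sub>L real) (g'' :: 'a \<Rightarrow> 'a \<Rightarrow>\<^sub>L 'a \<Rightarrow>\<^sub>L real).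
      (\<forall>x\<in>S. (g has_derivative blinfun_apply (g' x)) (at x within S)) \<and>
      (\<forall>x\<in>S. (g' has_derivative blinfun_apply (g'' x)) (at x within S)) \<and>
      continuous_on S g' \<and> continuous_on S g'')"

definition smooth_family ::
    "(real ^ 'd) set \<Rightarrow> (real ^ 'd \<Rightarrow> (nat \<Rightarrow> real) \<Rightarrow> real) \<Rightarrow> bool" where
  "smooth_family \<Theta> f \<longleftrightarrow>
    (\<forall>\<theta>\<in>\<Theta>. f \<theta> \<in> borel_measurable seq_space) \<and>
    (\<forall>\<theta>\<in>\<Theta>. \<forall>y\<in>space seq_space. 0 \<le> f \<theta> y) \<and>
    (\<forall>y\<in>space seq_space. C2_on (\<lambda>\<theta>. f \<theta> y) \<Theta>)"

text \<open>
  The coefficients \<open>\<alpha> k\<close> matter for \<open>k \<ge> 1\<close> only. The right-hand side of the Lipschitz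
  condition is an \<open>ennreal\<close> series: for some \<open>y, y'\<close> it is infinite, and the condition is void there
  (a real \<open>suminf\<close> would instead take an unspecified value).
\<close>

definition A0 ::
    "(real ^ 'd) set \<Rightarrow> (real ^ 'd \<Rightarrow> (nat \<Rightarrow> real) \<Rightarrow> real) \<Rightarrow> (nat \<Rightarrow> real) \<Rightarrow> bool" where
  "A0 \<Theta> f \<alpha> \<longleftrightarrow>
    sup_norm \<Theta> (\<lambda>\<theta>. f \<theta> zero_seq) < \<infinity> \<and>
    (\<forall>k\<ge>1. 0 \<le> \<alpha> k) \<and>
    summable (\<lambda>k. \<alpha> (Suc k)) \<and> (\<Sum>k. \<alpha> (Suc k)) < 1 \<and>
    (\<forall>y\<in>space seq_space. \<forall>y'\<in>space seq_space.
      sup_norm \<Theta> (\<lambda>\<theta>. f \<theta> y - f \<theta> y')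
        \<le> (\<Sum>k. ennreal (\<alpha> (Suc k) * \<bar>y (Suc k) - y' (Suc k)\<bar>)))"

definition D_cond ::
    "(real ^ 'd) set \<Rightarrow> (real ^ 'd \<Rightarrow> (nat \<Rightarrow> real) \<Rightarrow> real) \<Rightarrow> bool" where
  "D_cond \<Theta> f \<longleftrightarrow> (\<exists>c>0. \<forall>y\<in>space seq_space. c \<le> (INF \<theta>\<in>\<Theta>. f \<theta> y))"

text \<open>\<open>past Y t \<omega>\<close> is the sequence \<open>(Y\<^bsub>t-1\<^esub>(\<omega>), Y\<^bsub>t-2\<^esub>(\<omega>), \<dots>)\<close>.\<close>

definition past :: "(int \<Rightarrow> 'w \<Rightarrow> nat) \<Rightarrow> int \<Rightarrow> 'w \<Rightarrow> nat \<Rightarrow> real" where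
  "past Y t \<omega> = (\<lambda>k\<in>{1..}. real (Y (t - int k) \<omega>))"

text \<open>\<open>observed_past Y t \<omega>\<close> is the sequence \<open>(Y\<^bsub>t-1\<^esub>(\<omega>), \<dots>, Y\<^sub>1(\<omega>), 0, 0, \<dots>)\<close>.\<close>

definition observed_past :: "(int \<Rightarrow> 'w \<Rightarrow> nat) \<Rightarrow> int \<Rightarrow> 'w \<Rightarrow> nat \<Rightarrow> real" where
  "observed_past Y t \<omega> = (\<lambda>k\<in>{1..}. if t - int k \<ge> 1 then real (Y (t - int k) \<omega>) else 0)"

definition Id_cond ::
    "'w measure \<Rightarrow> (int \<Rightarrow> 'w \<Rightarrow> nat) \<Rightarrow> int \<Rightarrow> (real ^ 'd) set \<Rightarrow>
      (real ^ 'd \<Rightarrow> (nat \<Rightarrow> real) \<Rightarrow> real) \<Rightarrow> bool" where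
  "Id_cond M Y kstar \<Theta> f \<longleftrightarrow>
    (\<forall>\<theta>\<in>\<Theta>. \<forall>\<theta>'\<in>\<Theta>.
      (\<exists>t>kstar. AE \<omega> in M. f \<theta> (past Y t \<omega>) = f \<theta>' (past Y t \<omega>)) \<longrightarrow> \<theta> = \<theta>')"

definition hist :: "'w measure \<Rightarrow> (int \<Rightarrow> 'w \<Rightarrow> nat) \<Rightarrow> int \<Rightarrow> 'w measure" where
  "hist M Y t = sigma (space M) {Y s -` A \<inter> space M | s A. s \<le> t}"

text \<open>
  The last two conjuncts express that, given \<open>hist M Y (t - 1)\<close>, the law of \<open>Y\<^sub>t\<close> is Poisson with
  rate \<open>\<lambda>\<^sub>t = f (past Y t)\<close>, and that \<open>\<lambda>\<^sub>t\<close> is the conditional mean of \<open>Y\<^sub>t\<close>.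
  The library's \<open>poisson_pmf\<close> is specified for positive rates only; under
  \<open>D_cond\<close> the rate is bounded below by a positive constant.
\<close>

definition poisson_autoregression ::
    "'w measure \<Rightarrow> (int \<Rightarrow> 'w \<Rightarrow> nat) \<Rightarrow> int \<Rightarrow> ((nat \<Rightarrow> real) \<Rightarrow> real) \<Rightarrow> bool" where
  "poisson_autoregression M Y kstar f \<longleftrightarrow>
    (\<forall>t. Y t \<in> measurable M (count_space UNIV)) \<and>
    (\<forall>t>kstar.
      (\<forall>A. AE \<omega> in M.
        real_cond_exp M (hist M Y (t - 1)) (indicator (Y t -` A \<inter> space M)) \<omega>
          = measure_pmf.prob (poisson_pmf (f (past Y t \<omega>))) A) \<and>
      (AE \<omega> in M.
        nn_cond_exp M (hist M Y (t - 1)) (\<lambda>\<omega>. ennreal (real (Y t \<omega>))) \<omega>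
          = ennreal (f (past Y t \<omega>))))"

definition log_lik ::
    "(real ^ 'd \<Rightarrow> (nat \<Rightarrow> real) \<Rightarrow> real) \<Rightarrow> (int \<Rightarrow> 'w \<Rightarrow> nat) \<Rightarrow> int set \<Rightarrow> real ^ 'd \<Rightarrow> 'w \<Rightarrow> real"
    where
  "log_lik f Y T \<theta> \<omega> =
    (\<Sum>t\<in>T. (real (Y t \<omega>) * ln (f \<theta> (observed_past Y t \<omega>)) - f \<theta> (observed_past Y t \<omega>)))"

text \<open>
  A maximizer need not be unique, so the estimator is any function picking one, with no
  measurability required.
\<close>

definition is_mle ::
    "'w measure \<Rightarrow> (real ^ 'd) set \<Rightarrow> (real ^ 'd \<Rightarrow> (nat \<Rightarrow> real) \<Rightarrow> real) \<Rightarrow>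
      (int \<Rightarrow> 'w \<Rightarrow> nat) \<Rightarrow> int set \<Rightarrow> ('w \<Rightarrow> real ^ 'd) \<Rightarrow> bool" where
  "is_mle M \<Theta> f Y T \<theta>hat \<longleftrightarrow>
    (\<forall>\<omega>\<in>space M. is_arg_max (\<lambda>\<theta>. log_lik f Y T \<theta> \<omega>) (\<lambda>\<theta>. \<theta> \<in> \<Theta>) (\<theta>hat \<omega>))"

end

theory Submission
  imports Defs "HOL-Real_Asymp.Real_Asymp"
begin

text \<open>
  The argument uses no ergodic theory. If \<open>E(exp X\<^sub>t | F\<^bsub>t-1\<^esub>) \<le> 1\<close> for all \<open>t\<close>, then Markov's
  inequality and Borel--Cantelli give \<open>X\<^sub>1 + \<dots> + X\<^sub>n \<le> \<epsilon> n\<close> eventually, almost surely. This is applied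
  to three families of \<open>X\<^sub>t\<close>.

  (i) Excesses \<open>(Y\<^sub>t - B)\<^sup>+\<close> against \<open>(\<lambda>\<^sub>t - B/2)\<^sup>+\<close>. As the Lipschitz coefficients have sum below 1,
  this is a contraction between thresholds \<open>B/2\<close> and \<open>B\<close>, so the empirical means of \<open>(Y\<^sub>t - B)\<^sup>+\<close> are
  eventually small for large \<open>B\<close>.

  (ii) Indicators of \<open>Y\<^sub>t = k\<close> while \<open>\<lambda>\<^sub>t\<close> is bounded. Hence every finite pattern of counts recurs with
  positive frequency after a past of small influence. A parameter \<open>\<theta> \<noteq> \<theta>*\<close> differs from \<open>\<theta>*\<close> on some
  finitely supported sequence, by identifiability and continuity, so the mean of
  \<open>(\<surd>\<lambda>\<^sub>t(\<theta>) - \<surd>\<lambda>\<^sub>t)\<^sup>2\<close> stays bounded away from 0.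

  (iii) Half log-likelihood ratios \<open>Y\<^sub>t log (h\<^sub>t/\<lambda>\<^sub>t)/2 - \<surd>(\<lambda>\<^sub>t h\<^sub>t) + \<lambda>\<^sub>t\<close>, where \<open>h\<^sub>t\<close> is a predictable upper
  bound for the intensities of all parameters in a small ball. With (ii) and the control (i) of the
  oscillation over the ball, the likelihood on the ball eventually stays below the one at \<open>\<theta>*\<close>.
  Compactness concludes. The unobserved past is harmless since its influence on \<open>\<lambda>\<^sub>t\<close> tends to 0.
\<close>

section \<open>Exponential supermartingales of Poisson autoregressions\<close>

lemma poisson_exp_linear:
  assumes "0 < \<mu>"
  shows "(\<integral>\<^sup>+ k. ennreal (exp (v * real k)) \<partial>measure_pmf (poisson_pmf \<mu>)) = ennreal (exp (\<mu> * (exp v - 1)))"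
proof -
  have s: "(\<lambda>k. (\<mu> * exp v) ^ k /\<^sub>R fact k * exp (-\<mu>)) sums (exp (\<mu> * exp v) * exp (-\<mu>))"
    by (intro sums_mult2 exp_converges)
  have e: "pmf (poisson_pmf \<mu>) k * exp (v * real k) = (\<mu> * exp v) ^ k /\<^sub>R fact k * exp (-\<mu>)" for k
    using assms by (simp add: power_mult_distrib exp_of_nat2_mult divide_inverse)
  have "(\<integral>\<^sup>+ k. ennreal (exp (v * real k)) \<partial>measure_pmf (poisson_pmf \<mu>))
     = (\<Sum>k. ennreal (pmf (poisson_pmf \<mu>) k) * ennreal (exp (v * real k)))"
    by (simp only: nn_integral_measure_pmf nn_integral_count_space_nat)
  also have "\<dots> = (\<Sum>k. ennreal (pmf (poisson_pmf \<mu>) k * exp (v * real k)))"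
    by (simp only: ennreal_mult[OF pmf_nonneg exp_ge_zero])
  also have "\<dots> = ennreal (exp (\<mu> * exp v) * exp (-\<mu>))"
    unfolding e by (rule suminf_ennreal_eq[OF _ s]) (use assms in auto)
  also have "exp (\<mu> * exp v) * exp (-\<mu>) = exp (\<mu> * (exp v - 1))"
    unfolding mult_exp_exp by (simp add: right_diff_distrib)
  finally show ?thesis .
qed

lemma poisson_exp_indicator:
  shows "(\<integral>\<^sup>+ k. ennreal (exp (- (if k = j then 1 else 0))) \<partial>measure_pmf (poisson_pmf \<mu>))
    = ennreal (1 - pmf (poisson_pmf \<mu>) j * (1 - exp (-1)))"
proof -
  let ?p = "measure_pmf (poisson_pmf \<mu>)"
  have "(\<integral>\<^sup>+ k. ennreal (exp (- (if k = j then 1 else 0))) \<partial>?p)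
      = (\<integral>k. exp (- (if k = j then 1 else 0)) \<partial>?p)"
    by (intro nn_integral_eq_integral measure_pmf.integrable_const_bound[where B=1]) auto
  also have "(\<integral>k. exp (- (if k = j then 1 else 0)) \<partial>?p)
      = (\<integral>k. 1 - (1 - exp (-1)) * indicator {j} k \<partial>?p)"
    by (intro Bochner_Integration.integral_cong) (auto simp: indicator_def)
  also have "\<dots> = 1 - (1 - exp (-1)) * pmf (poisson_pmf \<mu>) j"
    by (subst Bochner_Integration.integral_diff)
       (auto simp: measure_pmf_single measure_pmf.prob_space measure_pmf.emeasure_finite less_top[symmetric]
         simp del: pmf_poisson)
  finally show ?thesis by (simp only: mult.commute)
qed

section \<open>Histories and integration along the conditional law\<close>

lemma space_hist [simp]: "space (hist M Y t) = space M"
  unfolding hist_def by (rule space_measure_of) auto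

lemma sets_hist: "sets (hist M Y t) = sigma_sets (space M) {Y s -` A \<inter> space M | s A. s \<le> t}"
  unfolding hist_def by (rule sets_measure_of) auto

lemma Y_hist: "s \<le> t \<Longrightarrow> Y s \<in> measurable (hist M Y t) (count_space UNIV)"
  by (rule measurableI) (auto simp: sets_hist intro!: sigma_sets.Basic)

text \<open>The conditional law is recorded only through its point masses; as counts are discrete,
  these determine every integral needed later.\<close>

locale poisson_process = prob_space M for M :: "'w measure" +
  fixes Y :: "int \<Rightarrow> 'w \<Rightarrow> nat" and \<mu> :: "int \<Rightarrow> 'w \<Rightarrow> real"
  assumes Y_measurable [measurable]: "Y t \<in> measurable M (count_space UNIV)"
    and rate_measurable: "0 < t \<Longrightarrow> \<mu> t \<in> borel_measurable (hist M Y (t - 1))"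
    and rate_pos: "0 < t \<Longrightarrow> \<omega> \<in> space M \<Longrightarrow> 0 < \<mu> t \<omega>"
    and cond_prob: "0 < t \<Longrightarrow> AE \<omega> in M. real_cond_exp M (hist M Y (t - 1))
          (indicator (Y t -` {k} \<inter> space M)) \<omega> = pmf (poisson_pmf (\<mu> t \<omega>)) k"
begin

lemma hist_subset: "sets (hist M Y t) \<subseteq> sets M"
  unfolding sets_hist by (rule sets.sigma_sets_subset) (auto intro!: measurable_sets[OF Y_measurable])

lemma hist_mono: "s \<le> t \<Longrightarrow> sets (hist M Y s) \<subseteq> sets (hist M Y t)"
  unfolding sets_hist by (rule sigma_sets_subseteq) (blast intro: order_trans)

lemma subalgebra_hist: "subalgebra M (hist M Y t)"
  unfolding subalgebra_def using hist_subset by simp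

lemma measurable_hist_mono:
  assumes "f \<in> measurable (hist M Y s) N" "s \<le> t"
  shows "f \<in> measurable (hist M Y t) N"
proof -
  have "subalgebra (hist M Y t) (hist M Y s)"
    unfolding subalgebra_def using hist_mono[OF assms(2)] by simp
  then show ?thesis using assms(1) by (rule measurable_from_subalg)
qed

lemma measurable_hist_M: "f \<in> measurable (hist M Y s) N \<Longrightarrow> f \<in> measurable M N"
  by (rule measurable_from_subalg[OF subalgebra_hist])

text \<open>Cutting the integral along the values \<open>k\<close> of \<open>Y t\<close> leaves
  history-measurable functions times indicators of \<open>Y t = k\<close>, and there the indicator
  may be replaced by its conditional probability. Summing over \<open>k\<close> avoids regular
  conditional distributions.\<close>

lemma nn_integral_disintegrate:
  fixes g :: "nat \<Rightarrow> 'w \<Rightarrow> ennreal"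
  assumes t: "0 < t" and g: "\<And>k. g k \<in> borel_measurable (hist M Y (t - 1))"
  shows "(\<integral>\<^sup>+ \<omega>. g (Y t \<omega>) \<omega> \<partial>M)
       = (\<integral>\<^sup>+ \<omega>. (\<integral>\<^sup>+ k. g k \<omega> \<partial>measure_pmf (poisson_pmf (\<mu> t \<omega>))) \<partial>M)"
proof -
  let ?F = "hist M Y (t - 1)"
  interpret F: sigma_finite_subalgebra M ?F
    by (intro finite_measure_subalgebra_is_sigma_finite finite_measure_subalgebra.intro
          finite_measure_axioms finite_measure_subalgebra_axioms.intro subalgebra_hist)
  have gM [measurable]: "g k \<in> borel_measurable M" for k
    using g by (rule measurable_hist_M)
  have lM: "\<mu> t \<in> borel_measurable M"
    using rate_measurable[OF t] by (rule measurable_hist_M)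
  have S [measurable]: "Y t -` {k} \<inter> space M \<in> sets M" for k
    by (rule measurable_sets[OF Y_measurable]) simp
  have one: "(\<integral>\<^sup>+ \<omega>. g k \<omega> * indicator (Y t -` {k} \<inter> space M) \<omega> \<partial>M)
     = (\<integral>\<^sup>+ \<omega>. g k \<omega> * ennreal (pmf (poisson_pmf (\<mu> t \<omega>)) k) \<partial>M)" for k
  proof -
    let ?S = "Y t -` {k} \<inter> space M"
    \<comment> \<open>\<open>real_cond_exp\<close> is a difference of \<open>enn2real\<close> images
      of non-negative conditional expectations. To recover \<open>h\<close> from it, the negative
      part has to vanish and \<open>h\<close> has to be finite almost everywhere.\<close>
    define h where "h = nn_cond_exp M ?F (\<lambda>\<omega>. ennreal (indicator ?S \<omega>))"
    have hm: "h \<in> borel_measurable M" unfolding h_def by measurable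
    have "(\<integral>\<^sup>+ \<omega>. h \<omega> \<partial>M) = (\<integral>\<^sup>+ \<omega>. ennreal (indicator ?S \<omega>) \<partial>M)"
      using F.nn_cond_exp_intg[of "\<lambda>_. 1" "\<lambda>\<omega>. ennreal (indicator ?S \<omega>)"] by (simp add: h_def)
    also have "\<dots> < \<infinity>"
      by (simp add: ennreal_indicator less_top[symmetric])
    finally have fin: "AE \<omega> in M. h \<omega> \<noteq> \<infinity>"
      by (intro nn_integral_noteq_infinite[OF hm]) auto
    have z: "AE \<omega> in M. (0::ennreal) = nn_cond_exp M ?F (\<lambda>_. 0) \<omega>"
      using F.nn_cond_exp_F_meas[of "\<lambda>_. 0"] by simp
    have eq: "AE \<omega> in M. h \<omega> = ennreal (pmf (poisson_pmf (\<mu> t \<omega>)) k)"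
      using fin z cond_prob[OF t, of k]
    proof eventually_elim
      case (elim \<omega>)
      have "(\<lambda>\<omega>. ennreal (- indicator ?S \<omega>)) = (\<lambda>\<omega>. 0)"
        by (auto simp: indicator_def ennreal_neg)
      then have "enn2real (h \<omega>) = pmf (poisson_pmf (\<mu> t \<omega>)) k"
        using elim(2,3) by (simp add: real_cond_exp_def h_def)
      then show ?case using elim(1) by (metis ennreal_enn2real infinity_ennreal_def top.not_eq_extremum)
    qed
    have "(\<integral>\<^sup>+ \<omega>. g k \<omega> * indicator ?S \<omega> \<partial>M) = (\<integral>\<^sup>+ \<omega>. g k \<omega> * ennreal (indicator ?S \<omega>) \<partial>M)"
      by (simp add: ennreal_indicator)
    also have "\<dots> = (\<integral>\<^sup>+ \<omega>. g k \<omega> * h \<omega> \<partial>M)"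
      unfolding h_def by (rule F.nn_cond_exp_intg[symmetric]) (use g in auto)
    also have "\<dots> = (\<integral>\<^sup>+ \<omega>. g k \<omega> * ennreal (pmf (poisson_pmf (\<mu> t \<omega>)) k) \<partial>M)"
      by (rule nn_integral_cong_AE) (use eq in eventually_elim, simp)
    finally show ?thesis .
  qed
  have pm [measurable]: "(\<lambda>\<omega>. ennreal (pmf (poisson_pmf (\<mu> t \<omega>)) k)) \<in> borel_measurable M" for k
  proof -
    have "(\<lambda>\<omega>. ennreal (\<mu> t \<omega> ^ k / fact k * exp (- \<mu> t \<omega>))) \<in> borel_measurable M"
      using lM by measurable
    then show ?thesis
      by (subst measurable_cong) (auto simp: rate_pos[OF t])
  qed
  have "(\<integral>\<^sup>+ \<omega>. g (Y t \<omega>) \<omega> \<partial>M) = (\<integral>\<^sup>+ \<omega>. (\<Sum>k. g k \<omega> * indicator (Y t -` {k} \<inter> space M) \<omega>) \<partial>M)"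
  proof (rule nn_integral_cong)
    fix \<omega> assume w: "\<omega> \<in> space M"
    have "(\<Sum>k. g k \<omega> * indicator (Y t -` {k} \<inter> space M) \<omega>)
       = (\<Sum>k\<in>{Y t \<omega>}. g k \<omega> * indicator (Y t -` {k} \<inter> space M) \<omega>)"
      by (rule suminf_finite) auto
    then show "g (Y t \<omega>) \<omega> = (\<Sum>k. g k \<omega> * indicator (Y t -` {k} \<inter> space M) \<omega>)"
      using w by simp
  qed
  also have "\<dots> = (\<Sum>k. \<integral>\<^sup>+ \<omega>. g k \<omega> * indicator (Y t -` {k} \<inter> space M) \<omega> \<partial>M)"
    by (intro nn_integral_suminf borel_measurable_times_ennreal gM borel_measurable_indicator S)
  also have "\<dots> = (\<Sum>k. \<integral>\<^sup>+ \<omega>. g k \<omega> * ennreal (pmf (poisson_pmf (\<mu> t \<omega>)) k) \<partial>M)"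
    by (simp only: one)
  also have "\<dots> = (\<integral>\<^sup>+ \<omega>. (\<Sum>k. g k \<omega> * ennreal (pmf (poisson_pmf (\<mu> t \<omega>)) k)) \<partial>M)"
    by (rule nn_integral_suminf[symmetric]) measurable
  finally show ?thesis
    by (simp add: nn_integral_measure_pmf nn_integral_count_space_nat mult.commute del: pmf_poisson)
qed

section \<open>The exponential supermartingale bound\<close>

text \<open>Conditioning on the history before the last time leaves a factor at most 1, so induction
  on \<open>n\<close> applies. The shift \<open>j\<close> lets the increment with index
  \<open>t\<close> use the count at time \<open>t + j\<close>, as needed when patterns are built
  count by count.\<close>

lemma exp_sum_le_1:
  fixes X :: "nat \<Rightarrow> nat \<Rightarrow> 'w \<Rightarrow> real" and j :: nat
  assumes X: "\<And>t k. 1 \<le> t \<Longrightarrow> X t k \<in> borel_measurable (hist M Y (int (t + j) - 1))"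
    and le: "\<And>t \<omega>. 1 \<le> t \<Longrightarrow> \<omega> \<in> space M \<Longrightarrow>
      (\<integral>\<^sup>+ k. ennreal (exp (X t k \<omega>)) \<partial>measure_pmf (poisson_pmf (\<mu> (int (t + j)) \<omega>))) \<le> 1"
  shows "(\<integral>\<^sup>+ \<omega>. ennreal (exp (\<Sum>t=1..n. X t (Y (int (t + j)) \<omega>) \<omega>)) \<partial>M) \<le> 1"
proof (induction n)
  case 0
  show ?case by (simp add: emeasure_space_1)
next
  case (Suc n)
  define S where "S \<omega> = (\<Sum>t=1..n. X t (Y (int (t + j)) \<omega>) \<omega>)" for \<omega>
  let ?F = "hist M Y (int (Suc n + j) - 1)"
  have S: "S \<in> borel_measurable ?F"
    unfolding S_def
  proof (rule borel_measurable_sum)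
    fix t assume t: "t \<in> {1..n}"
    show "(\<lambda>\<omega>. X t (Y (int (t + j)) \<omega>) \<omega>) \<in> borel_measurable ?F"
      by (rule measurable_compose_countable[where f="X t", OF measurable_hist_mono[OF X] Y_hist]) (use t in auto)
  qed
  have "(\<integral>\<^sup>+ \<omega>. ennreal (exp (\<Sum>t=1..Suc n. X t (Y (int (t + j)) \<omega>) \<omega>)) \<partial>M)
     = (\<integral>\<^sup>+ \<omega>. ennreal (exp (S \<omega>)) * ennreal (exp (X (Suc n) (Y (int (Suc n + j)) \<omega>) \<omega>)) \<partial>M)"
    by (simp add: S_def exp_add ennreal_mult add.assoc)
  also have "\<dots> = (\<integral>\<^sup>+ \<omega>. (\<integral>\<^sup>+ k. ennreal (exp (S \<omega>)) * ennreal (exp (X (Suc n) k \<omega>))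
      \<partial>measure_pmf (poisson_pmf (\<mu> (int (Suc n + j)) \<omega>))) \<partial>M)"
    using S X[of "Suc n"]
    by (intro nn_integral_disintegrate[where g = "\<lambda>k \<omega>. ennreal (exp (S \<omega>)) * ennreal (exp (X (Suc n) k \<omega>))"]) auto
  also have "\<dots> \<le> (\<integral>\<^sup>+ \<omega>. ennreal (exp (S \<omega>)) \<partial>M)"
  proof (rule nn_integral_mono)
    fix \<omega> assume w: "\<omega> \<in> space M"
    show "(\<integral>\<^sup>+ k. ennreal (exp (S \<omega>)) * ennreal (exp (X (Suc n) k \<omega>))
      \<partial>measure_pmf (poisson_pmf (\<mu> (int (Suc n + j)) \<omega>))) \<le> ennreal (exp (S \<omega>))"
      using mult_left_mono[OF le[of "Suc n" \<omega>], of "ennreal (exp (S \<omega>))"] w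
      by (simp add: nn_integral_cmult)
  qed
  also have "\<dots> \<le> 1"
    using Suc.IH by (simp add: S_def)
  finally show ?case .
qed

lemma exp_supermartingale_bound:
  fixes X :: "nat \<Rightarrow> nat \<Rightarrow> 'w \<Rightarrow> real" and j :: nat
  assumes X: "\<And>t k. 1 \<le> t \<Longrightarrow> X t k \<in> borel_measurable (hist M Y (int (t + j) - 1))"
    and le: "\<And>t \<omega>. 1 \<le> t \<Longrightarrow> \<omega> \<in> space M \<Longrightarrow>
      (\<integral>\<^sup>+ k. ennreal (exp (X t k \<omega>)) \<partial>measure_pmf (poisson_pmf (\<mu> (int (t + j)) \<omega>))) \<le> 1"
    and "0 < \<epsilon>"
  shows "AE \<omega> in M. \<forall>\<^sub>F n in sequentially. (\<Sum>t=1..n. X t (Y (int (t + j)) \<omega>) \<omega>) \<le> \<epsilon> * real n"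
proof -
  define S where "S n \<omega> = (\<Sum>t=1..n. X t (Y (int (t + j)) \<omega>) \<omega>)" for n \<omega>
  have S [measurable]: "S n \<in> borel_measurable M" for n
    unfolding S_def
    by (rule borel_measurable_sum, rule measurable_compose_countable[OF measurable_hist_M[OF X] Y_measurable]) simp
  \<comment> \<open>\<open>A n\<close> is the event that \<open>S n\<close> reaches
    \<open>\<epsilon> * n\<close>, written with threshold 1 to fit Markov's inequality.\<close>
  define A where "A n = {\<omega> \<in> space M. 1 \<le> ennreal (exp (- \<epsilon> * real n)) * ennreal (exp (S n \<omega>))}" for n
  have A [measurable]: "A n \<in> sets M" for n
    unfolding A_def by measurable
  have "emeasure M (A n) \<le> ennreal (exp (-\<epsilon>) ^ n)" for n
  proof -
    have "emeasure M (A n) \<le> ennreal (exp (- \<epsilon> * real n)) * (\<integral>\<^sup>+ \<omega>. ennreal (exp (S n \<omega>)) * indicator (space M) \<omega> \<partial>M)"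
      unfolding A_def by (rule order_trans[OF _ nn_integral_Markov_inequality]) (auto intro!: emeasure_mono)
    also have "(\<integral>\<^sup>+ \<omega>. ennreal (exp (S n \<omega>)) * indicator (space M) \<omega> \<partial>M) = (\<integral>\<^sup>+ \<omega>. ennreal (exp (S n \<omega>)) \<partial>M)"
      by (rule nn_integral_cong) simp
    also have "ennreal (exp (- \<epsilon> * real n)) * \<dots> \<le> ennreal (exp (- \<epsilon> * real n)) * 1"
      using exp_sum_le_1[where X=X and j=j and n=n, OF X le] by (intro mult_left_mono) (auto simp: S_def)
    also have "\<dots> = ennreal (exp (-\<epsilon>) ^ n)"
      using exp_of_nat_mult[of n "-\<epsilon>"] by (simp add: mult.commute)
    finally show ?thesis .
  qed
  then have m: "measure M (A n) \<le> exp (-\<epsilon>) ^ n" for n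
    by (simp add: measure_def enn2real_leI)
  have "summable (\<lambda>n. measure M (A n))"
    by (rule summable_comparison_test'[where N=0, OF summable_geometric[of "exp (-\<epsilon>)"]])
       (use m \<open>0 < \<epsilon>\<close> in auto)
  then have "AE \<omega> in M. \<forall>\<^sub>F n in sequentially. \<omega> \<in> space M - A n"
    by (intro borel_cantelli_AE1) (auto simp: less_top[symmetric])
  then show ?thesis
  proof eventually_elim
    case (elim \<omega>)
    then show ?case
    proof eventually_elim
      case (elim n)
      then have "\<not> 1 \<le> exp (- \<epsilon> * real n) * exp (S n \<omega>)"
        by (auto simp: A_def ennreal_mult[symmetric] simp del: mult_minus_left)
      then have "\<not> 0 \<le> - \<epsilon> * real n + S n \<omega>"
        by (metis exp_add one_le_exp_iff)
      then show ?case unfolding S_def by simp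
    qed
  qed
qed

section \<open>Almost sure bounds for Poisson counts\<close>

text \<open>Tilting by half the log ratio, \<open>v = ln (h / m) / 2\<close>, gives
  \<open>m * exp v = sqrt (m * h)\<close>, so the conditional exponential moment is exactly 1. The
  compensator \<open>m - sqrt (m * h)\<close> is
  \<open>(sqrt m - sqrt h)^2 / 2 + (m - h) / 2\<close>, which contains a squared Hellinger-type
  distance.\<close>

lemma hellinger_bound:
  fixes h :: "nat \<Rightarrow> 'w \<Rightarrow> real"
  assumes h: "\<And>t. 1 \<le> t \<Longrightarrow> h t \<in> borel_measurable (hist M Y (int t - 1))"
    and hpos: "\<And>t \<omega>. 1 \<le> t \<Longrightarrow> \<omega> \<in> space M \<Longrightarrow> 0 < h t \<omega>"
    and "0 < \<epsilon>"
  shows "AE \<omega> in M. \<forall>\<^sub>F n in sequentially.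
    (\<Sum>t=1..n. real (Y (int t) \<omega>) * ln (h t \<omega> / \<mu> (int t) \<omega>) / 2
        - sqrt (\<mu> (int t) \<omega> * h t \<omega>) + \<mu> (int t) \<omega>) \<le> \<epsilon> * real n"
proof -
  define X where "X t k \<omega> = real k * ln (h t \<omega> / \<mu> (int t) \<omega>) / 2
        - sqrt (\<mu> (int t) \<omega> * h t \<omega>) + \<mu> (int t) \<omega>" for t k \<omega>
  have "AE \<omega> in M. \<forall>\<^sub>F n in sequentially. (\<Sum>t=1..n. X t (Y (int (t + 0)) \<omega>) \<omega>) \<le> \<epsilon> * real n"
  proof (rule exp_supermartingale_bound)
    fix t k :: nat assume t: "1 \<le> t"
    then have [measurable]: "h t \<in> borel_measurable (hist M Y (int t - 1))"
      "\<mu> (int t) \<in> borel_measurable (hist M Y (int t - 1))"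
      using h rate_measurable by auto
    show "X t k \<in> borel_measurable (hist M Y (int (t + 0) - 1))"
      unfolding X_def by simp
  next
    fix t :: nat and \<omega> assume t: "1 \<le> t" and w: "\<omega> \<in> space M"
    define m where "m = \<mu> (int t) \<omega>"
    define v where "v = ln (h t \<omega> / m) / 2"
    have m: "0 < m" using rate_pos[of "int t"] t w by (simp add: m_def)
    have hp: "0 < h t \<omega>" using hpos t w by simp
    have "exp v = sqrt (h t \<omega> / m)"
      unfolding v_def using m hp by (simp add: ln_sqrt[symmetric])
    then have "m * exp v = sqrt (m * m) * sqrt (h t \<omega> / m)"
      using m by simp
    also have "\<dots> = sqrt (m * h t \<omega>)"
      unfolding real_sqrt_mult[symmetric] using m by simp
    finally have ev: "m * exp v = sqrt (m * h t \<omega>)" .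
    have "(\<integral>\<^sup>+ k. ennreal (exp (X t k \<omega>)) \<partial>measure_pmf (poisson_pmf m))
       = (\<integral>\<^sup>+ k. ennreal (exp (m - sqrt (m * h t \<omega>))) * ennreal (exp (v * real k)) \<partial>measure_pmf (poisson_pmf m))"
      by (intro nn_integral_cong) (simp add: X_def v_def m_def ennreal_mult[symmetric] mult_exp_exp mult.commute)
    also have "\<dots> = ennreal (exp (m - sqrt (m * h t \<omega>))) * ennreal (exp (m * (exp v - 1)))"
      using m by (simp add: nn_integral_cmult poisson_exp_linear)
    also have "\<dots> = 1"
      using ev by (simp add: ennreal_mult[symmetric] mult_exp_exp right_diff_distrib)
    finally show "(\<integral>\<^sup>+ k. ennreal (exp (X t k \<omega>)) \<partial>measure_pmf (poisson_pmf (\<mu> (int (t + 0)) \<omega>))) \<le> 1"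
      by (simp add: m_def)
  qed fact
  then show ?thesis by (simp add: X_def)
qed

text \<open>Since \<open>exp (u * max 0 (k - B)) \<le> 1 + exp (u * (k - B))\<close>, the Poisson
  Laplace transform controls the excess. Comparing with the excess of the rate over the lower
  threshold \<open>B / 2\<close> leaves an error that is exponentially small in \<open>B\<close>
  when \<open>\<delta> < 1\<close>.\<close>

lemma excess_bound:
  fixes B u \<delta> :: real
  assumes "0 \<le> B" "0 < u" "0 \<le> \<delta>" and u: "exp u - 1 \<le> (1 + \<delta>) * u"
    and "0 < \<epsilon>"
  shows "AE \<omega> in M. \<forall>\<^sub>F n in sequentially.
    (\<Sum>t=1..n. max 0 (real (Y (int t) \<omega>) - B))
      \<le> (1 + \<delta>) * (\<Sum>t=1..n. max 0 (\<mu> (int t) \<omega> - B / 2))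
        + (exp (- u * B * (1 - \<delta>) / 2) / u + \<epsilon>) * real n"
proof -
  define e where "e = exp (- u * B * (1 - \<delta>) / 2)"
  define X where "X t k \<omega> = u * max 0 (real k - B) - u * (1 + \<delta>) * max 0 (\<mu> (int t) \<omega> - B / 2) - e"
    for t k \<omega>
  have "AE \<omega> in M. \<forall>\<^sub>F n in sequentially. (\<Sum>t=1..n. X t (Y (int (t + 0)) \<omega>) \<omega>) \<le> (u * \<epsilon>) * real n"
  proof (rule exp_supermartingale_bound)
    fix t k :: nat assume t: "1 \<le> t"
    then have [measurable]: "\<mu> (int t) \<in> borel_measurable (hist M Y (int t - 1))"
      using rate_measurable by auto
    show "X t k \<in> borel_measurable (hist M Y (int (t + 0) - 1))"
      unfolding X_def by simp
  next
    fix t :: nat and \<omega> assume t: "1 \<le> t" and w: "\<omega> \<in> space M"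
    define m where "m = \<mu> (int t) \<omega>"
    define r where "r = u * (1 + \<delta>) * max 0 (m - B / 2)"
    have m: "0 < m" using rate_pos[of "int t"] t w by (simp add: m_def)
    have r: "0 \<le> r" using assms by (simp add: r_def)
    have "m * (exp u - 1) - u * B \<le> m * ((1 + \<delta>) * u) - u * B"
      using u m by simp
    \<comment> \<open>Of \<open>u * B\<close>, the share \<open>(1 + \<delta>) / 2\<close> centres
      the rate at \<open>B / 2\<close>; the remaining \<open>(1 - \<delta>) / 2\<close> becomes the
      decay in \<open>e\<close>.\<close>
    also have "\<dots> = u * (1 + \<delta>) * (m - B / 2) - u * B * (1 - \<delta>) / 2"
      by (simp add: field_simps)
    also have "\<dots> \<le> r - u * B * (1 - \<delta>) / 2"
      using assms unfolding r_def by (intro diff_right_mono mult_left_mono) auto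
    finally have key: "m * (exp u - 1) - u * B \<le> r - u * B * (1 - \<delta>) / 2" .
    have "(\<integral>\<^sup>+ k. ennreal (exp (X t k \<omega>)) \<partial>measure_pmf (poisson_pmf m))
       = ennreal (exp (- r - e)) * (\<integral>\<^sup>+ k. ennreal (exp (u * max 0 (real k - B))) \<partial>measure_pmf (poisson_pmf m))"
      by (subst nn_integral_cmult[symmetric])
         (auto intro!: nn_integral_cong simp: X_def m_def r_def ennreal_mult[symmetric] mult_exp_exp algebra_simps)
    also have "(\<integral>\<^sup>+ k. ennreal (exp (u * max 0 (real k - B))) \<partial>measure_pmf (poisson_pmf m))
       \<le> (\<integral>\<^sup>+ k. 1 + ennreal (exp (- u * B)) * ennreal (exp (u * real k)) \<partial>measure_pmf (poisson_pmf m))"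
    proof (rule nn_integral_mono)
      fix k :: nat
      have "exp (u * max 0 (real k - B)) \<le> 1 + exp (u * (real k - B))"
        by (cases "real k \<le> B") (auto simp: max_def)
      also have "exp (u * (real k - B)) = exp (- u * B) * exp (u * real k)"
        by (simp add: mult_exp_exp algebra_simps)
      finally have "ennreal (exp (u * max 0 (real k - B))) \<le> ennreal (1 + exp (- u * B) * exp (u * real k))"
        by (rule ennreal_leI)
      then show "ennreal (exp (u * max 0 (real k - B))) \<le> 1 + ennreal (exp (- u * B)) * ennreal (exp (u * real k))"
        by (simp add: ennreal_plus ennreal_mult)
    qed
    also have "\<dots> = 1 + ennreal (exp (- u * B)) * ennreal (exp (m * (exp u - 1)))"
      using m by (simp add: nn_integral_add nn_integral_cmult poisson_exp_linear measure_pmf.emeasure_space_1[simplified])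
    also have "\<dots> = ennreal (1 + exp (m * (exp u - 1) - u * B))"
      by (simp add: ennreal_plus ennreal_mult[symmetric] mult_exp_exp)
    also have "\<dots> \<le> ennreal (exp (r + e))"
    proof (rule ennreal_leI)
      have "exp (m * (exp u - 1) - u * B) \<le> exp (r - u * B * (1 - \<delta>) / 2)"
        using key by simp
      also have "\<dots> = exp r * e"
        by (simp add: e_def mult_exp_exp)
      finally have "exp (m * (exp u - 1) - u * B) \<le> exp r * e" .
      moreover have "1 \<le> exp r" using r by simp
      ultimately have "1 + exp (m * (exp u - 1) - u * B) \<le> exp r + exp r * e" by linarith
      also have "\<dots> = exp r * (1 + e)" by (simp add: algebra_simps)
      also have "\<dots> \<le> exp r * exp e"
        by (intro mult_left_mono) (auto intro: exp_ge_add_one_self)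
      finally show "1 + exp (m * (exp u - 1) - u * B) \<le> exp (r + e)"
        by (simp add: exp_add)
    qed
    finally have "(\<integral>\<^sup>+ k. ennreal (exp (X t k \<omega>)) \<partial>measure_pmf (poisson_pmf m))
       \<le> ennreal (exp (- r - e)) * ennreal (exp (r + e))"
      by (simp add: mult_left_mono)
    also have "\<dots> = 1" by (simp add: ennreal_mult[symmetric] mult_exp_exp)
    finally show "(\<integral>\<^sup>+ k. ennreal (exp (X t k \<omega>)) \<partial>measure_pmf (poisson_pmf (\<mu> (int (t + 0)) \<omega>))) \<le> 1"
      by (simp add: m_def)
  qed (use assms in simp)
  then show ?thesis
  proof eventually_elim
    case (elim \<omega>)
    then show ?case
    proof eventually_elim
      case (elim n)
      have "(\<Sum>t=1..n. X t (Y (int (t + 0)) \<omega>) \<omega>)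
         = u * (\<Sum>t=1..n. max 0 (real (Y (int t) \<omega>) - B))
          - u * (1 + \<delta>) * (\<Sum>t=1..n. max 0 (\<mu> (int t) \<omega> - B / 2)) - e * real n"
        unfolding X_def sum_subtractf sum_distrib_left by simp
      then have "u * (\<Sum>t=1..n. max 0 (real (Y (int t) \<omega>) - B))
          \<le> u * ((1 + \<delta>) * (\<Sum>t=1..n. max 0 (\<mu> (int t) \<omega> - B / 2)) + (e / u + \<epsilon>) * real n)"
        using elim \<open>0 < u\<close> by (simp add: algebra_simps)
      then show ?case using \<open>0 < u\<close> by (simp add: e_def)
    qed
  qed
qed

text \<open>On \<open>G t\<close> the rate lies between \<open>c\<close> and \<open>L\<close>, so
  the value \<open>k\<close> has conditional probability at least
  \<open>c ^ k / fact k * exp (- L)\<close>. The mean of \<open>exp\<close> of minus its indicator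
  is then at most \<open>1 - s \<le> exp (- s)\<close>, which compensates the factor
  \<open>exp s\<close>.\<close>

lemma frequency_bound:
  fixes G :: "nat \<Rightarrow> 'w set" and j k :: nat and c L \<epsilon> :: real
  assumes G: "\<And>t. 1 \<le> t \<Longrightarrow> G t \<in> sets (hist M Y (int (t + j) - 1))"
    and c: "0 < c" and L: "\<And>t \<omega>. 1 \<le> t \<Longrightarrow> \<omega> \<in> G t \<Longrightarrow> c \<le> \<mu> (int (t + j)) \<omega> \<and> \<mu> (int (t + j)) \<omega> \<le> L"
    and "0 < \<epsilon>"
  shows "AE \<omega> in M. \<forall>\<^sub>F n in sequentially.
     c ^ k / fact k * exp (- L) * (1 - exp (- 1)) * (\<Sum>t=1..n. indicator (G t) \<omega>)
      \<le> (\<Sum>t=1..n. indicator (G t) \<omega> * (if Y (int (t + j)) \<omega> = k then 1 else 0)) + \<epsilon> * real n"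
proof -
  define s where "s = c ^ k / fact k * exp (- L) * (1 - exp (- 1))"
  define X where "X t i \<omega> = indicator (G t) \<omega> * (s - (if i = k then 1 else 0))" for t i \<omega>
  have "AE \<omega> in M. \<forall>\<^sub>F n in sequentially. (\<Sum>t=1..n. X t (Y (int (t + j)) \<omega>) \<omega>) \<le> \<epsilon> * real n"
  proof (rule exp_supermartingale_bound)
    fix t i :: nat assume t: "1 \<le> t"
    show "X t i \<in> borel_measurable (hist M Y (int (t + j) - 1))"
      unfolding X_def using G[OF t] by measurable
  next
    fix t :: nat and \<omega> assume t: "1 \<le> t" and w: "\<omega> \<in> space M"
    define m where "m = \<mu> (int (t + j)) \<omega>"
    have m: "0 < m" using rate_pos[of "int (t + j)"] t w by (simp add: m_def)
    show "(\<integral>\<^sup>+ i. ennreal (exp (X t i \<omega>)) \<partial>measure_pmf (poisson_pmf (\<mu> (int (t + j)) \<omega>))) \<le> 1"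
    proof (cases "\<omega> \<in> G t")
      case True
      have cm: "c \<le> m" "m \<le> L" using L[OF t True] by (auto simp: m_def)
      have "c ^ k / fact k * exp (- L) \<le> m ^ k / fact k * exp (- m)"
        using cm c by (intro mult_mono divide_right_mono power_mono) auto
      then have q: "s \<le> pmf (poisson_pmf m) k * (1 - exp (-1))"
        unfolding s_def pmf_poisson[OF m] by (intro mult_right_mono) auto
      have "(\<integral>\<^sup>+ i. ennreal (exp (X t i \<omega>)) \<partial>measure_pmf (poisson_pmf m))
        = (\<integral>\<^sup>+ i. ennreal (exp s) * ennreal (exp (- (if i = k then 1 else 0))) \<partial>measure_pmf (poisson_pmf m))"
        using True by (intro nn_integral_cong) (simp add: X_def ennreal_mult[symmetric] mult_exp_exp)
      also have "\<dots> = ennreal (exp s) * ennreal (1 - pmf (poisson_pmf m) k * (1 - exp (-1)))"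
        by (subst nn_integral_cmult) (simp_all only: poisson_exp_indicator, simp)
      also have "\<dots> \<le> ennreal (exp s) * ennreal (exp (- s))"
        using q exp_ge_add_one_self[of "-s"] by (intro mult_left_mono ennreal_leI) auto
      also have "\<dots> = 1" by (simp add: ennreal_mult[symmetric] mult_exp_exp)
      finally show ?thesis by (simp add: m_def)
    qed (simp add: X_def measure_pmf.emeasure_space_1[simplified])
  qed fact
  then show ?thesis
  proof eventually_elim
    case (elim \<omega>)
    then show ?case
    proof eventually_elim
      case (elim n)
      have "(\<Sum>t=1..n. X t (Y (int (t + j)) \<omega>) \<omega>) = s * (\<Sum>t=1..n. indicator (G t) \<omega>)
          - (\<Sum>t=1..n. indicator (G t) \<omega> * (if Y (int (t + j)) \<omega> = k then 1 else 0))"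
        unfolding X_def sum_subtractf sum_distrib_left right_diff_distrib by (simp only: mult.commute)
      with elim show ?case unfolding s_def by linarith
    qed
  qed
qed

end

section \<open>Empirical means of large counts\<close>

text \<open>Meets the hypothesis on \<open>u\<close> in \<open>excess_bound\<close> with
  \<open>\<delta> = u\<close>.\<close>

lemma exp_increment_le: "0 \<le> u \<Longrightarrow> u \<le> 1 \<Longrightarrow> exp u - 1 \<le> (1 + u) * (u::real)"
  using exp_bound[of u] by (simp add: power2_eq_square algebra_simps)

text \<open>After exchanging the order of summation, each \<open>u s\<close> is multiplied by
  \<open>b\<close> at distinct lags, hence by at most the full series.\<close>

lemma sum_convolution_le:
  fixes b u :: "nat \<Rightarrow> real"
  assumes b: "\<And>k. 1 \<le> k \<Longrightarrow> 0 \<le> b k" "summable (\<lambda>k. b (Suc k))" and u: "\<And>s. 0 \<le> u s"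
  shows "(\<Sum>t=1..n. \<Sum>k=1..<t. b k * u (t - k)) \<le> (\<Sum>k. b (Suc k)) * (\<Sum>s=1..n. u s)"
proof -
  have "(\<Sum>t=1..n. \<Sum>k=1..<t. b k * u (t - k)) = (\<Sum>t=1..n. \<Sum>s=1..<t. b (t - s) * u s)"
  proof (rule sum.cong[OF refl])
    fix t
    show "(\<Sum>k=1..<t. b k * u (t - k)) = (\<Sum>s=1..<t. b (t - s) * u s)"
      by (rule sum.reindex_bij_witness[where i = "\<lambda>s. t - s" and j = "\<lambda>k. t - k"]) auto
  qed
  also have "\<dots> = (\<Sum>(t, s)\<in>Sigma {1..n} (\<lambda>t. {1..<t}). b (t - s) * u s)"
    by (rule sum.Sigma) auto
  also have "\<dots> = (\<Sum>(s, t)\<in>Sigma {1..n} (\<lambda>s. {Suc s..n}). b (t - s) * u s)"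
    by (rule sum.reindex_bij_witness[where i = "\<lambda>(s, t). (t, s)" and j = "\<lambda>(t, s). (s, t)"]) auto
  also have "\<dots> = (\<Sum>s=1..n. \<Sum>t=Suc s..n. b (t - s) * u s)"
    by (rule sum.Sigma[symmetric]) auto
  also have "\<dots> \<le> (\<Sum>s=1..n. (\<Sum>k. b (Suc k)) * u s)"
  proof (rule sum_mono)
    fix s assume "s \<in> {1..n}"
    have "(\<Sum>t=Suc s..n. b (t - s)) = (\<Sum>k<n - s. b (Suc k))"
      by (rule sum.reindex_bij_witness[where i = "\<lambda>k. k + Suc s" and j = "\<lambda>t. t - Suc s"]) (auto simp: Suc_diff_Suc)
    also have "\<dots> \<le> (\<Sum>k. b (Suc k))"
      using b by (intro sum_le_suminf) auto
    finally show "(\<Sum>t=Suc s..n. b (t - s) * u s) \<le> (\<Sum>k. b (Suc k)) * u s"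
      unfolding sum_distrib_right[symmetric] using u by (rule mult_right_mono)
  qed
  finally show ?thesis by (simp add: sum_distrib_left)
qed

text \<open>A Cesaro argument: beyond some \<open>N\<close> the factors \<open>r t\<close> are small
  while the means of \<open>y\<close> stay bounded, and the first \<open>N\<close> terms form a
  constant that is eventually negligible against \<open>n\<close>.\<close>

lemma sum_mult_null_le:
  fixes r y :: "nat \<Rightarrow> real"
  assumes r: "r \<longlonglongrightarrow> 0" and y: "\<And>t. 0 \<le> y t" and V: "\<forall>\<^sub>F n in sequentially. (\<Sum>t=1..n. y t) \<le> V * real n"
    and "0 < \<epsilon>"
  shows "\<forall>\<^sub>F n in sequentially. (\<Sum>t=1..n. y t * r t) \<le> \<epsilon> * real n"
proof -
  define e where "e = \<epsilon> / (2 * (\<bar>V\<bar> + 1))"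
  have e: "0 < e" using \<open>0 < \<epsilon>\<close> by (simp add: e_def)
  obtain N where N: "\<And>t. N \<le> t \<Longrightarrow> \<bar>r t\<bar> < e"
    using LIMSEQ_D[OF r e] by auto
  define C where "C = (\<Sum>t=1..N. y t * \<bar>r t\<bar>)"
  obtain n0 :: nat where n0: "2 * C / \<epsilon> \<le> real n0" using real_arch_simple by blast
  show ?thesis
    using V eventually_ge_at_top[of n0] eventually_ge_at_top[of N]
  proof eventually_elim
    case (elim n)
    have "(\<Sum>t=1..n. y t * r t) \<le> (\<Sum>t=1..n. (if t \<le> N then y t * \<bar>r t\<bar> else 0) + e * y t)"
    proof (rule sum_mono)
      fix t
      show "y t * r t \<le> (if t \<le> N then y t * \<bar>r t\<bar> else 0) + e * y t"
      proof (cases "t \<le> N")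
        case True
        have "y t * r t \<le> y t * \<bar>r t\<bar>" using y by (intro mult_left_mono) auto
        moreover have "0 \<le> e * y t" using e y by simp
        ultimately show ?thesis using True by simp
      next
        case False
        then have "r t \<le> e" using N[of t] by simp
        from mult_left_mono[OF this, of "y t"] show ?thesis
          using False y by (simp add: mult.commute)
      qed
    qed
    also have "\<dots> = (\<Sum>t=1..n. if t \<le> N then y t * \<bar>r t\<bar> else 0) + e * (\<Sum>t=1..n. y t)"
      by (simp add: sum.distrib sum_distrib_left)
    also have "(\<Sum>t=1..n. if t \<le> N then y t * \<bar>r t\<bar> else 0) = C"
      unfolding C_def using elim(3) by (intro sum.mono_neutral_cong_right) auto
    also have "C \<le> \<epsilon> / 2 * real n"
    proof -
      have "2 * C / \<epsilon> \<le> real n" using n0 elim(2) by linarith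
      then show ?thesis using \<open>0 < \<epsilon>\<close> by (simp add: field_simps)
    qed
    also have "e * (\<Sum>t=1..n. y t) \<le> e * ((\<bar>V\<bar> + 1) * real n)"
    proof (rule mult_left_mono)
      have "V * real n \<le> (\<bar>V\<bar> + 1) * real n" by (intro mult_right_mono) auto
      then show "(\<Sum>t=1..n. y t) \<le> (\<bar>V\<bar> + 1) * real n" using elim(1) by linarith
    qed (use e in simp)
    also have "\<dots> = \<epsilon> / 2 * real n" by (simp add: e_def field_simps)
    finally show ?case by simp
  qed
qed

text \<open>Factor \<open>x - y\<close> as \<open>(sqrt x - sqrt y) * (sqrt x + sqrt y)\<close>; the
  second factor is at most \<open>2 * sqrt U\<close>.\<close>

lemma sqrt_diff_ge:
  fixes x y :: real
  assumes "0 \<le> x" "0 \<le> y" "x \<le> U" "y \<le> U" "0 < U" "0 \<le> d" "d \<le> \<bar>x - y\<bar>"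
  shows "d\<^sup>2 / (4 * U) \<le> (sqrt x - sqrt y)\<^sup>2"
proof -
  have "(sqrt x + sqrt y)\<^sup>2 \<le> (2 * sqrt U)\<^sup>2"
    using assms by (intro power_mono) (auto intro!: add_mono[of "sqrt x" "sqrt U" "sqrt y" "sqrt U", simplified])
  also have "\<dots> = 4 * U" using assms by (simp add: power_mult_distrib)
  finally have le: "(sqrt x + sqrt y)\<^sup>2 \<le> 4 * U" .
  have "d\<^sup>2 \<le> \<bar>x - y\<bar>\<^sup>2" using assms by (intro power_mono) auto
  also have "\<bar>x - y\<bar>\<^sup>2 = ((sqrt x - sqrt y) * (sqrt x + sqrt y))\<^sup>2"
    using assms by (simp add: algebra_simps)
  also have "\<dots> = (sqrt x - sqrt y)\<^sup>2 * (sqrt x + sqrt y)\<^sup>2" by (simp add: power_mult_distrib)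
  also have "\<dots> \<le> (sqrt x - sqrt y)\<^sup>2 * (4 * U)" using le by (intro mult_left_mono) auto
  finally show ?thesis using assms by (simp add: pos_divide_le_eq)
qed

text \<open>Made for one summand of the log-likelihood difference: \<open>x\<close> is the intensity
  at a parameter near a centre, \<open>g\<close> that at the centre, \<open>w\<close> the
  oscillation, \<open>l\<close> the true rate and \<open>s\<close> its version from the observed
  past. The majorant \<open>g + w\<close> replaces \<open>x\<close> in the logarithm; half the
  squared distance of the roots of \<open>g\<close> and \<open>l\<close> is the gain.\<close>

lemma log_likelihood_term_le:
  fixes y x g w s l r c :: real
  assumes "0 \<le> y" "0 < c" "c \<le> x" "c \<le> g" "c \<le> s" "c \<le> l" and xg: "\<bar>x - g\<bar> \<le> w" and ls: "\<bar>l - s\<bar> \<le> r"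
  shows "(y * ln x - x) - (y * ln s - s)
     \<le> 2 * (y * ln ((g + w) / l) / 2 - sqrt (l * (g + w)) + l)
        - (sqrt g - sqrt l)\<^sup>2 / 2 + (3 * w + (y * r / c + r))"
proof -
  have w: "0 \<le> w" and r: "0 \<le> r" using xg ls by linarith+
  have "ln x \<le> ln (g + w)" using assms by simp
  moreover have "ln l - ln s \<le> r / c"
  proof -
    have "ln l - ln s = ln (l / s)" using assms by (simp add: ln_div)
    also have "\<dots> \<le> l / s - 1" using assms by (intro ln_le_minus_one) auto
    also have "\<dots> = (l - s) / s" using assms by (simp add: diff_divide_distrib)
    also have "\<dots> \<le> r / c" using assms r by (intro frac_le) auto
    finally show ?thesis .
  qed
  moreover have "ln ((g + w) / l) = ln (g + w) - ln l" using assms w by (simp add: ln_div)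
  ultimately have "ln x - ln s \<le> ln ((g + w) / l) + r / c" by linarith
  then have "y * (ln x - ln s) \<le> y * (ln ((g + w) / l) + r / c)" using assms(1) by (rule mult_left_mono)
  then have 1: "y * ln x - y * ln s \<le> y * ln ((g + w) / l) + y * r / c" by (simp add: algebra_simps)
  define p q v where "p = sqrt g" and "q = sqrt (g + w)" and "v = sqrt l"
  have pq: "0 \<le> p" "p \<le> q" "p\<^sup>2 = g" "q\<^sup>2 = g + w" "v\<^sup>2 = l" "sqrt (l * (g + w)) = v * q"
    using assms w by (auto simp: p_def q_def v_def real_sqrt_mult)
  \<comment> \<open>Moving from \<open>g + w\<close> back to the centre \<open>g\<close> costs at
    most \<open>w\<close>; up to this cost, half of \<open>(p - v)^2\<close> is kept.\<close>
  have "(q - p)\<^sup>2 \<le> (q - p) * (q + p)"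
    using pq unfolding power2_eq_square by (intro mult_left_mono) auto
  also have "\<dots> = w" using pq(3,4) by (simp add: power2_eq_square algebra_simps)
  finally have "(q - p)\<^sup>2 \<le> w" .
  moreover have "(p - v)\<^sup>2 \<le> 2 * (q - v)\<^sup>2 + 2 * (q - p)\<^sup>2"
    using zero_le_power2[of "(q - v) + (q - p)"] by (simp add: power2_eq_square algebra_simps)
  moreover have "(q - v)\<^sup>2 = (g + w) + l - 2 * (v * q)"
    using pq(4,5) by (simp add: power2_diff mult.commute)
  ultimately have "2 * (v * q) - g - l \<le> - (p - v)\<^sup>2 / 2 + 2 * w" by linarith
  then have 2: "2 * sqrt (l * (g + w)) - g - l \<le> - (sqrt g - sqrt l)\<^sup>2 / 2 + 2 * w"
    by (simp only: pq(6) p_def v_def)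
  show ?thesis using 1 2 xg ls by (simp add: abs_le_iff)
qed

section \<open>Truncated sequences and measurability of pasts\<close>

definition truncate_seq :: "nat \<Rightarrow> (nat \<Rightarrow> real) \<Rightarrow> nat \<Rightarrow> real" where
  "truncate_seq m y = (\<lambda>k\<in>{1..}. if k < m then y k else 0)"

lemma seq_space_iff: "y \<in> space seq_space \<longleftrightarrow> y \<in> extensional {1..} \<and> (\<forall>k\<ge>1. 0 \<le> y k)"
  by (auto simp: seq_space_def space_PiM space_restrict_space PiE_iff)

lemma zero_seq_space [simp]: "zero_seq \<in> space seq_space"
  by (auto simp: seq_space_iff zero_seq_def)

lemma past_space [simp]: "past Y t \<omega> \<in> space seq_space"
  by (auto simp: seq_space_iff past_def)

lemma observed_past_space [simp]: "observed_past Y t \<omega> \<in> space seq_space"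
  by (auto simp: seq_space_iff observed_past_def)

lemma truncate_seq_space [simp]: "y \<in> space seq_space \<Longrightarrow> truncate_seq m y \<in> space seq_space"
  by (auto simp: seq_space_iff truncate_seq_def)

lemma truncate_seq_apply [simp]: "truncate_seq m y (Suc k) = (if Suc k < m then y (Suc k) else 0)"
  by (simp add: truncate_seq_def)

lemma observed_past_apply:
  "observed_past Y (int t) \<omega> (Suc k) = (if Suc k < t then real (Y (int (t - Suc k)) \<omega>) else 0)"
  by (auto simp: observed_past_def of_nat_diff)

lemma past_apply [simp]: "past Y t \<omega> (Suc k) = real (Y (t - int (Suc k)) \<omega>)"
  by (simp add: past_def)

lemma past_measurable: "past Y t \<in> measurable (hist M Y (t - 1)) seq_space"
  unfolding past_def seq_space_def
  by (intro measurable_restrict measurable_restrict_space2 measurable_compose[OF Y_hist]) auto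

lemma observed_past_measurable: "observed_past Y t \<in> measurable (hist M Y (t - 1)) seq_space"
  unfolding observed_past_def seq_space_def
proof (intro measurable_restrict measurable_restrict_space2)
  fix k :: nat assume "k \<in> {1..}"
  then show "(\<lambda>\<omega>. if 1 \<le> t - int k then real (Y (t - int k) \<omega>) else 0) \<in> borel_measurable (hist M Y (t - 1))"
    by (cases "1 \<le> t - int k") (auto intro!: measurable_compose[OF Y_hist])
qed auto

definition pattern_seq :: "(nat \<Rightarrow> nat) \<Rightarrow> nat \<Rightarrow> real" where
  "pattern_seq q = (\<lambda>k\<in>{1..}. real (q k))"

lemma pattern_seq_space [simp]: "pattern_seq q \<in> space seq_space"
  by (auto simp: pattern_seq_def seq_space_iff)

lemma truncate_past: "truncate_seq m (past Y t \<omega>) = pattern_seq (\<lambda>k. if k < m then Y (t - int k) \<omega> else 0)"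
  by (auto simp: truncate_seq_def past_def pattern_seq_def)

text \<open>
  Since the majorant \<open>\<beta>\<close> of \<open>\<alpha>\<close> is decreasing, a single \<open>\<beta>\<close>-weighted sum of the past before time \<open>t\<close> bounds
  the influence of that past on the rates at all times from \<open>t\<close> on.
\<close>

locale poisson_family = poisson_process M Y "\<lambda>t \<omega>. f \<theta>s (past Y t \<omega>)"
  for M :: "'w measure" and Y :: "int \<Rightarrow> 'w \<Rightarrow> nat"
    and f :: "'p::metric_space \<Rightarrow> (nat \<Rightarrow> real) \<Rightarrow> real" and \<theta>s :: 'p +
  fixes \<Theta> :: "'p set" and \<alpha> \<beta> :: "nat \<Rightarrow> real" and c F K :: real
  assumes \<theta>s: "\<theta>s \<in> \<Theta>"
    and f_measurable: "\<theta> \<in> \<Theta> \<Longrightarrow> f \<theta> \<in> borel_measurable seq_space"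
    and f_cont: "y \<in> space seq_space \<Longrightarrow> continuous_on \<Theta> (\<lambda>\<theta>. f \<theta> y)"
    and c_pos: "0 < c" and c_le: "\<theta> \<in> \<Theta> \<Longrightarrow> y \<in> space seq_space \<Longrightarrow> c \<le> f \<theta> y"
    and F_ge: "\<theta> \<in> \<Theta> \<Longrightarrow> f \<theta> zero_seq \<le> F"
    and \<alpha>_nonneg: "1 \<le> k \<Longrightarrow> 0 \<le> \<alpha> k"
    and \<alpha>_sum: "(\<Sum>k. \<alpha> (Suc k)) < 1"
    and lip: "\<theta> \<in> \<Theta> \<Longrightarrow> y \<in> space seq_space \<Longrightarrow> y' \<in> space seq_space \<Longrightarrow>
        summable (\<lambda>k. \<alpha> (Suc k) * \<bar>y (Suc k) - y' (Suc k)\<bar>) \<Longrightarrow>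
        \<bar>f \<theta> y - f \<theta> y'\<bar> \<le> (\<Sum>k. \<alpha> (Suc k) * \<bar>y (Suc k) - y' (Suc k)\<bar>)"
    and \<beta>_decreasing: "1 \<le> i \<Longrightarrow> i \<le> j \<Longrightarrow> \<beta> j \<le> \<beta> i"
    and \<alpha>_le_\<beta>: "1 \<le> k \<Longrightarrow> \<alpha> k \<le> \<beta> k"
    and \<beta>_summable: "summable (\<lambda>k. \<beta> (Suc k))"
    and initial_moment: "t \<le> 0 \<Longrightarrow> (\<integral>\<^sup>+ \<omega>. ennreal (real (Y t \<omega>)) \<partial>M) \<le> ennreal K"
begin

section \<open>Influence of the unobserved past\<close>

abbreviation "rate t \<omega> \<equiv> f \<theta>s (past Y (int t) \<omega>)"

abbreviation initial_summable :: "'w \<Rightarrow> bool" where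
  "initial_summable \<omega> \<equiv> summable (\<lambda>s. \<beta> (Suc s) * real (Y (- int s) \<omega>))"

definition a where "a = (\<Sum>k. \<alpha> (Suc k))"

text \<open>A bound for the influence on time \<open>t\<close> of all counts up to time 0: the count
  at time \<open>- s\<close> sits at lag \<open>t + s\<close>.\<close>

definition remote :: "nat \<Rightarrow> 'w \<Rightarrow> real" where
  "remote t \<omega> = (\<Sum>s. \<beta> (t + s) * real (Y (- int s) \<omega>))"

lemma \<beta>_nonneg: "1 \<le> k \<Longrightarrow> 0 \<le> \<beta> k"
  using \<alpha>_nonneg \<alpha>_le_\<beta> order_trans by blast

lemma \<alpha>_summable: "summable (\<lambda>k. \<alpha> (Suc k))"
  by (rule summable_comparison_test'[OF \<beta>_summable, where N=0]) (simp add: \<alpha>_nonneg \<alpha>_le_\<beta>)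

lemma a_bounds: "0 \<le> a" "a < 1"
  using \<alpha>_sum suminf_nonneg[OF \<alpha>_summable] by (auto simp: a_def \<alpha>_nonneg)

lemma F_pos: "0 < F"
  using F_ge[OF \<theta>s] c_le[OF \<theta>s zero_seq_space] c_pos by simp

lemma lip_dominated:
  assumes "\<theta> \<in> \<Theta>" "y \<in> space seq_space" "y' \<in> space seq_space"
    and le: "\<And>k. \<alpha> (Suc k) * \<bar>y (Suc k) - y' (Suc k)\<bar> \<le> b k" and b: "summable b"
  shows "\<bar>f \<theta> y - f \<theta> y'\<bar> \<le> suminf b"
proof -
  have s: "summable (\<lambda>k. \<alpha> (Suc k) * \<bar>y (Suc k) - y' (Suc k)\<bar>)"
    by (rule summable_comparison_test'[OF b, where N=0]) (use le in \<open>simp add: \<alpha>_nonneg\<close>)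
  show ?thesis
    using lip[OF assms(1-3) s] suminf_le[OF le s b] by simp
qed

lemma lip_finite:
  assumes "\<theta> \<in> \<Theta>" "y \<in> space seq_space" "y' \<in> space seq_space"
    and le: "\<And>k. 1 \<le> k \<Longrightarrow> k < m \<Longrightarrow> \<alpha> k * \<bar>y k - y' k\<bar> \<le> b k" and eq: "\<And>k. m \<le> k \<Longrightarrow> 1 \<le> k \<Longrightarrow> y k = y' k"
  shows "\<bar>f \<theta> y - f \<theta> y'\<bar> \<le> (\<Sum>k=1..<m. b k)"
proof -
  let ?b = "\<lambda>k. if Suc k < m then b (Suc k) else 0"
  have "\<bar>f \<theta> y - f \<theta> y'\<bar> \<le> suminf ?b"
    using assms by (intro lip_dominated summable_finite[of "{..<m}"]) auto
  also have "suminf ?b = (\<Sum>k<m - 1. b (Suc k))"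
    by (subst suminf_finite[of "{..<m - 1}"]) (auto intro!: sum.cong)
  also have "\<dots> = (\<Sum>k=1..<m. b k)"
    by (rule sum.reindex_bij_witness[where i = "\<lambda>k. k - 1" and j = Suc]) auto
  finally show ?thesis .
qed

text \<open>The series has finite expectation, since first moments up to time 0 are uniformly
  bounded and \<open>\<beta>\<close> is summable.\<close>

lemma AE_initial_summable: "AE \<omega> in M. initial_summable \<omega>"
proof -
  have "(\<integral>\<^sup>+ \<omega>. (\<Sum>s. ennreal (\<beta> (Suc s) * real (Y (- int s) \<omega>))) \<partial>M)
     = (\<Sum>s. \<integral>\<^sup>+ \<omega>. ennreal (\<beta> (Suc s) * real (Y (- int s) \<omega>)) \<partial>M)"
    by (rule nn_integral_suminf) measurable
  also have "\<dots> \<le> (\<Sum>s. ennreal (\<beta> (Suc s)) * ennreal K)"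
  proof (intro suminf_le summableI)
    fix s :: nat
    have "(\<integral>\<^sup>+ \<omega>. ennreal (\<beta> (Suc s) * real (Y (- int s) \<omega>)) \<partial>M)
       = ennreal (\<beta> (Suc s)) * (\<integral>\<^sup>+ \<omega>. ennreal (real (Y (- int s) \<omega>)) \<partial>M)"
      by (subst nn_integral_cmult[symmetric]) (auto intro!: nn_integral_cong simp: ennreal_mult \<beta>_nonneg)
    also have "\<dots> \<le> ennreal (\<beta> (Suc s)) * ennreal K"
      by (intro mult_left_mono initial_moment) auto
    finally show "(\<integral>\<^sup>+ \<omega>. ennreal (\<beta> (Suc s) * real (Y (- int s) \<omega>)) \<partial>M) \<le> ennreal (\<beta> (Suc s)) * ennreal K" .
  qed
  also have "\<dots> = ennreal (\<Sum>s. \<beta> (Suc s)) * ennreal K"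
    using \<beta>_summable by (simp add: suminf_ennreal2 \<beta>_nonneg)
  also have "\<dots> < \<infinity>" by (simp add: ennreal_mult_less_top)
  finally have "AE \<omega> in M. (\<Sum>s. ennreal (\<beta> (Suc s) * real (Y (- int s) \<omega>))) \<noteq> \<infinity>"
    by (intro nn_integral_noteq_infinite) auto
  then show ?thesis
    by eventually_elim (rule summable_suminf_not_top, auto simp: \<beta>_nonneg)
qed

lemma remote_summable:
  assumes "initial_summable \<omega>" "1 \<le> t"
  shows "summable (\<lambda>s. \<beta> (t + s) * real (Y (- int s) \<omega>))"
proof (rule summable_comparison_test'[OF assms(1), where N=0])
  fix s
  show "norm (\<beta> (t + s) * real (Y (- int s) \<omega>)) \<le> \<beta> (Suc s) * real (Y (- int s) \<omega>)"
    using assms(2) \<beta>_nonneg[of "t + s"] by (auto simp: abs_mult intro!: mult_right_mono \<beta>_decreasing)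
qed

lemma remote_nonneg: "initial_summable \<omega> \<Longrightarrow> 1 \<le> t \<Longrightarrow> 0 \<le> remote t \<omega>"
  unfolding remote_def by (intro suminf_nonneg remote_summable mult_nonneg_nonneg \<beta>_nonneg) auto

text \<open>Dominated convergence for series: each term vanishes as \<open>\<beta>\<close> tends to
  0, and monotonicity of \<open>\<beta>\<close> makes the series at \<open>t = 1\<close>
  dominating.\<close>

lemma remote_tendsto_0:
  assumes "initial_summable \<omega>"
  shows "(\<lambda>t. remote t \<omega>) \<longlonglongrightarrow> 0"
proof -
  have b0: "\<beta> \<longlonglongrightarrow> 0"
    using LIMSEQ_offset[where k = 1 and f = \<beta>] summable_LIMSEQ_zero[OF \<beta>_summable] by simp
  have "((\<lambda>t. \<Sum>s. \<beta> (t + s) * real (Y (- int s) \<omega>)) \<longlongrightarrow> (\<Sum>s::nat. 0)) sequentially"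
  proof (rule tannerys_theorem[THEN conjunct2, THEN conjunct2])
    show "(\<lambda>t. \<beta> (t + s) * real (Y (- int s) \<omega>)) \<longlonglongrightarrow> 0" for s
      by (rule tendsto_mult_left_zero, rule LIMSEQ_ignore_initial_segment[OF b0])
    have "norm (\<beta> (t + s) * real (Y (- int s) \<omega>)) \<le> \<beta> (Suc s) * real (Y (- int s) \<omega>)" if "1 \<le> t" for t s
      using that \<beta>_nonneg[of "t + s"] by (auto simp: abs_mult intro!: mult_right_mono \<beta>_decreasing)
    then show "\<forall>\<^sub>F (s, t) in sequentially \<times>\<^sub>F sequentially.
        norm (\<beta> (t + s) * real (Y (- int s) \<omega>)) \<le> \<beta> (Suc s) * real (Y (- int s) \<omega>)"
      unfolding eventually_prod_sequentially by auto
  qed (use assms in auto)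
  then show ?thesis by (simp add: remote_def)
qed

lemma past_observed_diff:
  assumes s: "initial_summable \<omega>" and t: "1 \<le> t" and "\<theta> \<in> \<Theta>"
  shows "\<bar>f \<theta> (past Y (int t) \<omega>) - f \<theta> (observed_past Y (int t) \<omega>)\<bar> \<le> remote t \<omega>"
proof -
  \<comment> \<open>\<open>b\<close> vanishes at the lags below \<open>t\<close>, where both pasts
    agree. Index \<open>k\<close> stands for lag \<open>Suc k\<close>, so the shift by
    \<open>t - 1\<close> yields the series of \<open>remote t\<close>.\<close>
  define b where "b k = (if Suc k < t then 0 else \<beta> (Suc k) * real (Y (int t - int (Suc k)) \<omega>))" for k
  have sh: "b (k + (t - 1)) = \<beta> (t + k) * real (Y (- int k) \<omega>)" for k
    using t by (auto simp: b_def of_nat_diff add.commute)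
  have "summable (\<lambda>k. b (k + (t - 1)))"
    unfolding sh by (rule remote_summable[OF s t])
  then have sb: "summable b" by (simp only: summable_iff_shift)
  have "\<bar>f \<theta> (past Y (int t) \<omega>) - f \<theta> (observed_past Y (int t) \<omega>)\<bar> \<le> suminf b"
    using \<open>\<theta> \<in> \<Theta>\<close> past_space observed_past_space
  proof (rule lip_dominated[OF _ _ _ _ sb])
    fix k
    show "\<alpha> (Suc k) * \<bar>past Y (int t) \<omega> (Suc k) - observed_past Y (int t) \<omega> (Suc k)\<bar> \<le> b k"
      by (auto simp: b_def observed_past_apply of_nat_diff algebra_simps intro!: mult_right_mono \<alpha>_le_\<beta>)
  qed
  also have "suminf b = (\<Sum>k. b (k + (t - 1))) + (\<Sum>i<t - 1. b i)"
    by (rule suminf_split_initial_segment[OF sb])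
  also have "(\<Sum>i<t - 1. b i) = 0" by (rule sum.neutral) (auto simp: b_def)
  finally show ?thesis unfolding sh remote_def by simp
qed

section \<open>Contraction of the excesses\<close>

text \<open>Each count is at most \<open>B\<close> plus its excess, so the Lipschitz condition
  around \<open>zero_seq\<close> gives at most \<open>F + a * B\<close> plus weighted excesses.
  Subtracting \<open>B\<close> leaves \<open>F - (1 - a) * B\<close>, negative for large
  \<open>B\<close>.\<close>

lemma observed_excess:
  assumes "\<theta> \<in> \<Theta>" "0 \<le> B"
  shows "max 0 (f \<theta> (observed_past Y (int t) \<omega>) - B)
     \<le> max 0 (F - (1 - a) * B) + (\<Sum>k=1..<t. \<alpha> k * max 0 (real (Y (int (t - k)) \<omega>) - B))"
proof -
  let ?S = "\<Sum>k=1..<t. \<alpha> k * max 0 (real (Y (int (t - k)) \<omega>) - B)"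
  have S: "0 \<le> ?S" by (intro sum_nonneg mult_nonneg_nonneg \<alpha>_nonneg) auto
  have "\<bar>f \<theta> (observed_past Y (int t) \<omega>) - f \<theta> zero_seq\<bar> \<le> (\<Sum>k=1..<t. \<alpha> k * (B + max 0 (real (Y (int (t - k)) \<omega>) - B)))"
  proof (rule lip_finite[OF assms(1) observed_past_space zero_seq_space])
    fix k assume "1 \<le> k" "k < t"
    then show "\<alpha> k * \<bar>observed_past Y (int t) \<omega> k - zero_seq k\<bar> \<le> \<alpha> k * (B + max 0 (real (Y (int (t - k)) \<omega>) - B))"
      using assms(2) by (intro mult_left_mono \<alpha>_nonneg) (auto simp: observed_past_def zero_seq_def of_nat_diff)
  qed (auto simp: observed_past_def zero_seq_def)
  also have "\<dots> = B * (\<Sum>k=1..<t. \<alpha> k) + ?S"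
    by (simp add: distrib_left sum.distrib sum_distrib_left mult.commute)
  also have "(\<Sum>k=1..<t. \<alpha> k) = (\<Sum>k<t - 1. \<alpha> (Suc k))"
    by (rule sum.reindex_bij_witness[where i = Suc and j = "\<lambda>k. k - 1"]) auto
  also have "B * \<dots> \<le> B * a"
    unfolding a_def using assms(2) \<alpha>_summable by (intro mult_left_mono sum_le_suminf) (auto simp: \<alpha>_nonneg)
  finally have "f \<theta> (observed_past Y (int t) \<omega>) \<le> F + B * a + ?S"
    using F_ge[OF assms(1)] by linarith
  then have "f \<theta> (observed_past Y (int t) \<omega>) - B \<le> (F - (1 - a) * B) + ?S"
    by (simp add: algebra_simps)
  then show ?thesis using S by linarith
qed

lemma sum_rate_excess:
  assumes s: "initial_summable \<omega>" and B: "0 \<le> B"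
  shows "(\<Sum>t=1..n. max 0 (rate t \<omega> - B)) \<le> max 0 (F - (1 - a) * B) * real n
      + a * (\<Sum>t=1..n. max 0 (real (Y (int t) \<omega>) - B)) + (\<Sum>t=1..n. remote t \<omega>)"
proof -
  have "(\<Sum>t=1..n. max 0 (rate t \<omega> - B)) \<le> (\<Sum>t=1..n. max 0 (F - (1 - a) * B)
      + (\<Sum>k=1..<t. \<alpha> k * max 0 (real (Y (int (t - k)) \<omega>) - B)) + remote t \<omega>)"
  proof (rule sum_mono)
    fix t assume "t \<in> {1..n}"
    then show "max 0 (rate t \<omega> - B) \<le> max 0 (F - (1 - a) * B)
      + (\<Sum>k=1..<t. \<alpha> k * max 0 (real (Y (int (t - k)) \<omega>) - B)) + remote t \<omega>"
      using observed_excess[OF \<theta>s B, of t \<omega>] past_observed_diff[OF s _ \<theta>s, of t] remote_nonneg[OF s, of t]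
      by auto
  qed
  also have "\<dots> = max 0 (F - (1 - a) * B) * real n
      + (\<Sum>t=1..n. \<Sum>k=1..<t. \<alpha> k * max 0 (real (Y (int (t - k)) \<omega>) - B)) + (\<Sum>t=1..n. remote t \<omega>)"
    by (simp add: sum.distrib mult.commute)
  also have "(\<Sum>t=1..n. \<Sum>k=1..<t. \<alpha> k * max 0 (real (Y (int (t - k)) \<omega>) - B))
      \<le> a * (\<Sum>t=1..n. max 0 (real (Y (int t) \<omega>) - B))"
    unfolding a_def
    by (rule sum_convolution_le[where u = "\<lambda>s. max 0 (real (Y (int s) \<omega>) - B)"]) (auto simp: \<alpha>_nonneg \<alpha>_summable)
  finally show ?thesis by simp
qed

lemma sum_remote_le:
  assumes s: "initial_summable \<omega>" and "0 < \<epsilon>"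
  shows "\<forall>\<^sub>F n in sequentially. (\<Sum>t=1..n. remote t \<omega>) \<le> \<epsilon> * real n"
  using sum_mult_null_le[OF remote_tendsto_0[OF s], of "\<lambda>_. 1" 1 \<epsilon>] assms(2) by simp

definition mean_excess_le :: "real \<Rightarrow> real \<Rightarrow> bool" where
  "mean_excess_le B v \<longleftrightarrow>
    (AE \<omega> in M. \<forall>\<^sub>F n in sequentially. (\<Sum>t=1..n. max 0 (real (Y (int t) \<omega>) - B)) \<le> v * real n)"

lemma mean_excess_mono:
  assumes "mean_excess_le B v" "v \<le> w"
  shows "mean_excess_le B w"
  using assms(1) unfolding mean_excess_le_def
proof eventually_elim
  case (elim \<omega>)
  then show ?case
  proof eventually_elim
    case (elim n)
    also have "v * real n \<le> w * real n" using assms(2) by (intro mult_right_mono) auto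
    finally show ?case .
  qed
qed

text \<open>At threshold 0 the sum \<open>S\<close> of the counts is at most
  \<open>(1 + \<delta>) * a * S\<close> plus a multiple of \<open>n\<close>. The factor is below 1,
  so the inequality can be solved for \<open>S\<close>.\<close>

lemma mean_le: "\<exists>V>0. mean_excess_le 0 V"
proof -
  define \<delta> where "\<delta> = (1 - a) / 2"
  have \<delta>: "0 < \<delta>" "\<delta> \<le> 1" using a_bounds by (auto simp: \<delta>_def)
  \<comment> \<open>With \<open>\<delta> = (1 - a) / 2\<close> the two sides differ by
    \<open>(1 - a)^2 / 2\<close>.\<close>
  have \<rho>: "(1 + \<delta>) * a \<le> (1 + a) / 2"
    using zero_le_power2[of "1 - a"] by (simp add: \<delta>_def field_simps power2_eq_square)
  \<comment> \<open>The numerator collects \<open>(1 + \<delta>) * (F + 1) \<le> 2 * F + 2\<close>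
    and the error \<open>1 / \<delta> + 1\<close> of \<open>excess_bound\<close>, whose exponential
    is 1 at threshold 0.\<close>
  define V where "V = (2 * F + 1 / \<delta> + 3) / (1 - (1 + a) / 2)"
  have "0 < V" unfolding V_def using a_bounds F_pos \<delta> by (intro divide_pos_pos) (auto intro: add_nonneg_pos)
  have ex: "AE \<omega> in M. \<forall>\<^sub>F n in sequentially. (\<Sum>t=1..n. max 0 (real (Y (int t) \<omega>) - 0))
      \<le> (1 + \<delta>) * (\<Sum>t=1..n. max 0 (rate t \<omega> - 0)) + (1 / \<delta> + 1) * real n"
    using excess_bound[of 0 \<delta> \<delta> 1] exp_increment_le[of \<delta>] \<delta> by simp
  have "mean_excess_le 0 V"
    unfolding mean_excess_le_def
    using AE_initial_summable ex
  proof eventually_elim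
    case (elim \<omega>)
    show ?case
      using elim(2) sum_remote_le[OF elim(1) zero_less_one]
    proof eventually_elim
      case (elim n)
      define S where "S = (\<Sum>t=1..n. max 0 (real (Y (int t) \<omega>) - 0))"
      have S: "0 \<le> S" by (simp add: S_def sum_nonneg)
      have "(\<Sum>t=1..n. max 0 (rate t \<omega> - 0)) \<le> F * real n + a * S + real n"
        using sum_rate_excess[OF \<open>summable _\<close>, of 0 n] elim(2) F_pos by (simp add: S_def)
      then have "(1 + \<delta>) * (\<Sum>t=1..n. max 0 (rate t \<omega> - 0)) \<le> (1 + \<delta>) * (F * real n + a * S + real n)"
        using \<delta> by (intro mult_left_mono) auto
      then have "S \<le> (1 + \<delta>) * (F * real n + a * S + real n) + (1 / \<delta> + 1) * real n"
        using elim(1) by (simp add: S_def)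
      also have "(1 + \<delta>) * (F * real n + a * S + real n) = ((1 + \<delta>) * a) * S + (1 + \<delta>) * ((F + 1) * real n)"
        by (simp add: algebra_simps)
      also have "((1 + \<delta>) * a) * S \<le> ((1 + a) / 2) * S"
        using \<rho> S by (rule mult_right_mono)
      also have "(1 + \<delta>) * ((F + 1) * real n) \<le> 2 * ((F + 1) * real n)"
        using \<delta> F_pos by (intro mult_right_mono) auto
      finally have "(1 - (1 + a) / 2) * S \<le> (2 * F + 1 / \<delta> + 3) * real n"
        by (simp add: algebra_simps)
      then have "S \<le> V * real n"
        unfolding V_def using a_bounds by (simp add: field_simps)
      then show ?case by (simp add: S_def)
    qed
  qed
  with \<open>0 < V\<close> show ?thesis by blast
qed

text \<open>Count excesses over \<open>B'\<close> are bounded through rate excesses over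
  \<open>B' / 2\<close>, hence through \<open>a\<close> times count excesses over
  \<open>B' / 2\<close>, and \<open>v\<close> controls these once
  \<open>2 * B \<le> B'\<close>.\<close>

lemma mean_excess_contract:
  assumes v: "mean_excess_le B v" "0 \<le> B" and "0 < \<eta>"
  shows "\<exists>B'\<ge>0. mean_excess_le B' ((1 + a) / 2 * v + \<eta>)"
proof -
  define \<delta> where "\<delta> = (1 - a) / 2"
  have \<delta>: "0 < \<delta>" "\<delta> < 1" using a_bounds by (auto simp: \<delta>_def)
  have \<rho>: "(1 + \<delta>) * a \<le> (1 + a) / 2"
    using zero_le_power2[of "1 - a"] by (simp add: \<delta>_def field_simps power2_eq_square)
  have "((\<lambda>B. exp (- \<delta> * B * (1 - \<delta>) / 2) / \<delta>) \<longlongrightarrow> 0) at_top"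
    using \<delta> by real_asymp
  then have "\<forall>\<^sub>F B in at_top. exp (- \<delta> * B * (1 - \<delta>) / 2) / \<delta> < \<eta> / 4"
    by (rule order_tendstoD) (use \<open>0 < \<eta>\<close> in simp)
  \<comment> \<open>The three demands make the exponential error small, bring \<open>B' / 2\<close>
    above \<open>B\<close>, and remove the constant \<open>F - (1 - a) * B' / 2\<close>. Four errors
    \<open>\<eta> / 4\<close> add up to \<open>\<eta>\<close>; the one from \<open>remote\<close>
    counts twice because \<open>1 + \<delta> \<le> 2\<close>.\<close>
  then have "\<exists>B'. exp (- \<delta> * B' * (1 - \<delta>) / 2) / \<delta> < \<eta> / 4 \<and> 2 * B \<le> B' \<and> 2 * F / (1 - a) \<le> B'"
    by (intro eventually_happens'[OF trivial_limit_at_top_linorder] eventually_conj eventually_ge_at_top)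
  then obtain B' where B': "exp (- \<delta> * B' * (1 - \<delta>) / 2) / \<delta> < \<eta> / 4" "2 * B \<le> B'" "2 * F / (1 - a) \<le> B'"
    by blast
  have B'0: "0 \<le> B'" using B'(2) v(2) by simp
  have F0: "F - (1 - a) * (B' / 2) \<le> 0"
    using B'(3) a_bounds by (simp add: field_simps)
  have ex: "AE \<omega> in M. \<forall>\<^sub>F n in sequentially. (\<Sum>t=1..n. max 0 (real (Y (int t) \<omega>) - B'))
      \<le> (1 + \<delta>) * (\<Sum>t=1..n. max 0 (rate t \<omega> - B' / 2))
        + (exp (- \<delta> * B' * (1 - \<delta>) / 2) / \<delta> + \<eta> / 4) * real n"
    using exp_increment_le[of \<delta>] \<delta> B'0 \<open>0 < \<eta>\<close> by (intro excess_bound) auto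
  have "mean_excess_le B' ((1 + a) / 2 * v + \<eta>)"
    unfolding mean_excess_le_def
    using AE_initial_summable ex v(1)[unfolded mean_excess_le_def]
  proof eventually_elim
    case (elim \<omega>)
    have "0 < \<eta> / 4" using \<open>0 < \<eta>\<close> by simp
    show ?case
      using elim(2,3) sum_remote_le[OF elim(1) \<open>0 < \<eta> / 4\<close>]
    proof eventually_elim
      case (elim n)
      define S where "S = (\<Sum>t=1..n. max 0 (real (Y (int t) \<omega>) - B' / 2))"
      have "S \<le> (\<Sum>t=1..n. max 0 (real (Y (int t) \<omega>) - B))"
        unfolding S_def using B'(2) by (intro sum_mono) auto
      then have S: "S \<le> v * real n" "0 \<le> S" using elim(2) by (auto simp: S_def intro: sum_nonneg)
      have "(\<Sum>t=1..n. max 0 (rate t \<omega> - B' / 2)) \<le> a * S + (\<Sum>t=1..n. remote t \<omega>)"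
        using sum_rate_excess[OF \<open>summable _\<close>, of "B' / 2" n] B'0 F0 by (simp add: S_def)
      also have "\<dots> \<le> a * S + \<eta> / 4 * real n" using elim(3) by simp
      finally have "(1 + \<delta>) * (\<Sum>t=1..n. max 0 (rate t \<omega> - B' / 2)) \<le> (1 + \<delta>) * (a * S + \<eta> / 4 * real n)"
        using \<delta> by (intro mult_left_mono) auto
      also have "\<dots> = ((1 + \<delta>) * a) * S + (1 + \<delta>) * (\<eta> / 4 * real n)" by (simp add: algebra_simps)
      also have "((1 + \<delta>) * a) * S \<le> (1 + a) / 2 * S"
        using \<rho> S by (intro mult_right_mono) auto
      also have "(1 + a) / 2 * S \<le> (1 + a) / 2 * (v * real n)"
        using S a_bounds by (intro mult_left_mono) auto
      also have "(1 + \<delta>) * (\<eta> / 4 * real n) \<le> 2 * (\<eta> / 4 * real n)"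
        using \<delta> \<open>0 < \<eta>\<close> by (intro mult_right_mono) auto
      finally have "(\<Sum>t=1..n. max 0 (real (Y (int t) \<omega>) - B'))
          \<le> (1 + a) / 2 * (v * real n) + 2 * (\<eta> / 4 * real n)
            + (exp (- \<delta> * B' * (1 - \<delta>) / 2) / \<delta> + \<eta> / 4) * real n"
        using elim(1) by linarith
      also have "(exp (- \<delta> * B' * (1 - \<delta>) / 2) / \<delta> + \<eta> / 4) * real n \<le> (\<eta> / 4 + \<eta> / 4) * real n"
        using B'(1) by (intro mult_right_mono add_right_mono) auto
      finally show ?case by (simp add: algebra_simps)
    qed
  qed
  with B'0 show ?thesis by blast
qed

lemma mean_excess_small:
  assumes "0 < v"
  shows "\<exists>B\<ge>0. mean_excess_le B v"
proof -
  define \<rho> where "\<rho> = (1 + a) / 2"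
  have \<rho>: "0 \<le> \<rho>" "\<rho> < 1" using a_bounds by (auto simp: \<rho>_def)
  obtain V where V: "mean_excess_le 0 V" using mean_le by blast
  \<comment> \<open>This makes \<open>v / 2\<close> the fixed point of the map taking
    \<open>x\<close> to \<open>\<rho> * x + \<eta>\<close>, so the iterates are
    \<open>\<rho> ^ i * V + v / 2\<close>.\<close>
  define \<eta> where "\<eta> = (1 - \<rho>) * (v / 2)"
  have \<eta>: "0 < \<eta>" using \<rho> assms by (simp add: \<eta>_def)
  have it: "\<exists>B\<ge>0. mean_excess_le B (\<rho> ^ i * V + v / 2)" for i
  proof (induction i)
    case 0
    have "mean_excess_le 0 (V + v / 2)"
      using V by (rule mean_excess_mono) (use assms in simp)
    then show ?case by auto
  next
    case (Suc i)
    then obtain B where "0 \<le> B" "mean_excess_le B (\<rho> ^ i * V + v / 2)" by blast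
    from mean_excess_contract[OF this(2,1) \<eta>]
    have "\<exists>B\<ge>0. mean_excess_le B (\<rho> * (\<rho> ^ i * V + v / 2) + \<eta>)" by (simp only: \<rho>_def)
    moreover have "\<rho> * (\<rho> ^ i * V + v / 2) + \<eta> = \<rho> ^ Suc i * V + v / 2"
      by (simp add: \<eta>_def field_simps)
    ultimately show ?case by simp
  qed
  have "(\<lambda>i. \<rho> ^ i * V) \<longlonglongrightarrow> 0"
    using \<rho> by (intro tendsto_mult_left_zero LIMSEQ_realpow_zero) auto
  then have "\<forall>\<^sub>F i in sequentially. \<rho> ^ i * V < v / 2"
    by (rule order_tendstoD) (use assms in simp)
  then obtain i where i: "\<rho> ^ i * V < v / 2"
    by (meson eventually_happens sequentially_bot)
  obtain B where B: "0 \<le> B" "mean_excess_le B (\<rho> ^ i * V + v / 2)" using it by blast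
  have "mean_excess_le B v"
    using B(2) by (rule mean_excess_mono) (use i in simp)
  with B(1) show ?thesis by blast
qed

section \<open>Recurrence of finite patterns\<close>

lemma remote_measurable [measurable]:
  assumes "1 \<le> t"
  shows "remote t \<in> borel_measurable (hist M Y (int t - 1))"
  unfolding remote_def
  using assms by (intro borel_measurable_suminf borel_measurable_times borel_measurable_const
      measurable_compose[OF Y_hist]) auto

lemma \<beta>_shift_summable: "summable (\<lambda>k. \<beta> (Suc k + m))"
  using \<beta>_summable summable_iff_shift[of "\<lambda>k. \<beta> (Suc k)" m] by simp

text \<open>The influence on \<open>f \<theta>\<close> at time \<open>t + m\<close> of the values before time \<open>t\<close> is at most \<open>tail_influence m t\<close>.\<close>

definition tail_influence :: "nat \<Rightarrow> nat \<Rightarrow> 'w \<Rightarrow> real" where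
  "tail_influence m t \<omega> = (\<Sum>i=1..<t. \<beta> (i + m) * real (Y (int (t - i)) \<omega>)) + remote t \<omega>"

lemma tail_influence_measurable [measurable]:
  assumes "1 \<le> t"
  shows "tail_influence m t \<in> borel_measurable (hist M Y (int t - 1))"
  unfolding tail_influence_def
  using assms by (intro borel_measurable_add borel_measurable_sum borel_measurable_times borel_measurable_const
      remote_measurable measurable_compose[OF Y_hist]) auto

lemma tail_influence_antimono: "j \<le> m \<Longrightarrow> tail_influence m t \<omega> \<le> tail_influence j t \<omega>"
  unfolding tail_influence_def
  by (intro add_right_mono sum_mono mult_right_mono \<beta>_decreasing) auto

lemma tail_influence_nonneg: "initial_summable \<omega> \<Longrightarrow> 1 \<le> t \<Longrightarrow> 0 \<le> tail_influence m t \<omega>"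
  unfolding tail_influence_def
  by (intro add_nonneg_nonneg sum_nonneg mult_nonneg_nonneg \<beta>_nonneg remote_nonneg) auto

lemma past_truncate_diff:
  assumes s: "initial_summable \<omega>" and t: "1 \<le> t" and "\<theta> \<in> \<Theta>"
  shows "\<bar>f \<theta> (past Y (int (t + m)) \<omega>) - f \<theta> (truncate_seq (Suc m) (past Y (int (t + m)) \<omega>))\<bar>
    \<le> tail_influence m t \<omega>"
proof -
  \<comment> \<open>From lag \<open>t + m\<close> on, that is for times up to 0, the weight is
    \<open>\<beta>\<close> at the lag minus \<open>m\<close>. Monotonicity makes it a majorant, and
    the remainder becomes exactly \<open>remote t\<close>.\<close>
  define b where "b k = (if k < m then 0 else if k < t + m - 1 then \<beta> (Suc k) * real (Y (int (t + m) - int (Suc k)) \<omega>)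
     else \<beta> (Suc k - m) * real (Y (int (t + m) - int (Suc k)) \<omega>))" for k
  have sh: "b (k + (t + m - 1)) = \<beta> (t + k) * real (Y (- int k) \<omega>)" for k
    using t by (auto simp: b_def of_nat_diff algebra_simps Suc_diff_le)
  have "summable (\<lambda>k. b (k + (t + m - 1)))"
    unfolding sh by (rule remote_summable[OF s t])
  then have sb: "summable b" by (simp only: summable_iff_shift)
  have "\<bar>f \<theta> (past Y (int (t + m)) \<omega>) - f \<theta> (truncate_seq (Suc m) (past Y (int (t + m)) \<omega>))\<bar> \<le> suminf b"
    using \<open>\<theta> \<in> \<Theta>\<close> past_space truncate_seq_space[OF past_space]
  proof (rule lip_dominated[OF _ _ _ _ sb])
    fix k
    have "\<alpha> (Suc k) \<le> \<beta> (Suc k - m)" if "m \<le> k"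
      using that \<alpha>_le_\<beta>[of "Suc k"] \<beta>_decreasing[of "Suc k - m" "Suc k"] by (simp add: Suc_diff_le)
    then show "\<alpha> (Suc k) * \<bar>past Y (int (t + m)) \<omega> (Suc k) - truncate_seq (Suc m) (past Y (int (t + m)) \<omega>) (Suc k)\<bar> \<le> b k"
      by (auto simp: b_def intro!: mult_right_mono \<alpha>_le_\<beta>)
  qed
  also have "suminf b = (\<Sum>k. b (k + (t + m - 1))) + (\<Sum>i<t + m - 1. b i)"
    by (rule suminf_split_initial_segment[OF sb])
  also have "(\<Sum>i<t + m - 1. b i) = (\<Sum>i=m..<t + m - 1. b i)"
    by (rule sum.mono_neutral_right) (auto simp: b_def)
  also have "\<dots> = (\<Sum>i=1..<t. \<beta> (i + m) * real (Y (int (t - i)) \<omega>))"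
    by (rule sum.reindex_bij_witness[where i = "\<lambda>i. i + m - 1" and j = "\<lambda>k. k + 1 - m"])
       (auto simp: b_def of_nat_diff algebra_simps)
  finally show ?thesis unfolding sh by (simp add: tail_influence_def remote_def)
qed

lemma remote_antimono:
  assumes s: "initial_summable \<omega>" and "1 \<le> t"
  shows "remote (t + m) \<omega> \<le> remote t \<omega>"
  unfolding remote_def
  using assms by (intro suminf_le remote_summable mult_right_mono \<beta>_decreasing) auto

lemma remote_le_tail_influence: "remote t \<omega> \<le> tail_influence m t \<omega>"
  unfolding tail_influence_def by (auto intro!: sum_nonneg mult_nonneg_nonneg \<beta>_nonneg)

text \<open>The convolution kernel is \<open>\<beta>\<close> shifted by \<open>m\<close>, whose sum
  is a tail of a convergent series; the mean influence is thus small for large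
  \<open>m\<close>.\<close>

lemma mean_tail_influence:
  assumes s: "initial_summable \<omega>" and V: "\<forall>\<^sub>F n in sequentially. (\<Sum>t=1..n. real (Y (int t) \<omega>)) \<le> V * real n"
    and "0 < \<epsilon>"
  shows "\<forall>\<^sub>F n in sequentially. (\<Sum>t=1..n. tail_influence m t \<omega>) \<le> ((\<Sum>k. \<beta> (Suc k + m)) * V + \<epsilon>) * real n"
  using V sum_remote_le[OF s \<open>0 < \<epsilon>\<close>]
proof eventually_elim
  case (elim n)
  have "(\<Sum>t=1..n. \<Sum>i=1..<t. \<beta> (i + m) * real (Y (int (t - i)) \<omega>))
     \<le> (\<Sum>k. \<beta> (Suc k + m)) * (\<Sum>t=1..n. real (Y (int t) \<omega>))"
    by (rule sum_convolution_le[where b = "\<lambda>i. \<beta> (i + m)" and u = "\<lambda>s. real (Y (int s) \<omega>)"])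
       (auto intro!: \<beta>_nonneg \<beta>_shift_summable[simplified])
  also have "\<dots> \<le> (\<Sum>k. \<beta> (Suc k + m)) * (V * real n)"
    using elim(1) by (intro mult_left_mono suminf_nonneg \<beta>_shift_summable \<beta>_nonneg) auto
  finally show ?case
    using elim(2) by (simp add: tail_influence_def sum.distrib algebra_simps)
qed

text \<open>The bound \<open>B\<close> keeps the rates bounded while a pattern is being formed; the
  bound \<open>\<eta>\<close> makes the past before \<open>t\<close> nearly irrelevant
  \<open>m\<close> steps later.\<close>

definition quiet_past :: "real \<Rightarrow> nat \<Rightarrow> real \<Rightarrow> nat \<Rightarrow> 'w set" where
  "quiet_past B m \<eta> t = {\<omega> \<in> space M. tail_influence 0 t \<omega> \<le> B \<and> tail_influence m t \<omega> \<le> \<eta>}"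

lemma quiet_past_sets: "1 \<le> t \<Longrightarrow> quiet_past B m \<eta> t \<in> sets (hist M Y (int t - 1))"
proof -
  assume t: "1 \<le> t"
  note [measurable] = tail_influence_measurable[OF t]
  have "{\<omega> \<in> space (hist M Y (int t - 1)). tail_influence 0 t \<omega> \<le> B \<and> tail_influence m t \<omega> \<le> \<eta>}
      \<in> sets (hist M Y (int t - 1))"
    by measurable
  then show ?thesis by (simp add: quiet_past_def)
qed

text \<open>Markov's inequality for empirical means: if the past is not quiet,
  \<open>tail_influence 0 t / B\<close> or \<open>tail_influence m t / \<eta>\<close> exceeds 1, and
  each ratio has mean at most 1/4.\<close>

lemma quiet_past_frequent:
  assumes "0 < \<eta>"
  shows "\<exists>B>0. \<exists>m\<ge>m0. AE \<omega> in M. \<forall>\<^sub>F n in sequentially.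
    1 / 2 * real n \<le> (\<Sum>t=1..n. indicator (quiet_past B m \<eta> t) \<omega>)"
proof -
  obtain V where "0 < V" and V: "mean_excess_le 0 V" using mean_le by blast
  obtain N where N: "\<And>m. N \<le> m \<Longrightarrow> norm (\<Sum>k. \<beta> (Suc (k + m))) < \<eta> / (8 * V)"
    using suminf_exist_split[OF _ \<beta>_summable, of "\<eta> / (8 * V)"] assms \<open>0 < V\<close> by auto
  have "\<forall>\<^sub>F m in sequentially. (\<Sum>k. \<beta> (Suc k + m)) < \<eta> / (8 * V)"
    using eventually_ge_at_top[of N]
  proof eventually_elim
    case (elim m)
    then show ?case using N[OF elim] by simp
  qed
  then have "\<forall>\<^sub>F m in sequentially. (\<Sum>k. \<beta> (Suc k + m)) < \<eta> / (8 * V) \<and> m0 \<le> m"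
    by (intro eventually_conj eventually_ge_at_top)
  then obtain m where m: "(\<Sum>k. \<beta> (Suc k + m)) < \<eta> / (8 * V)" "m0 \<le> m"
    using eventually_happens'[OF sequentially_bot] by blast
  define b where "b = (\<Sum>k. \<beta> (Suc k))"
  have b: "0 \<le> b" unfolding b_def by (intro suminf_nonneg \<beta>_summable \<beta>_nonneg) auto
  \<comment> \<open>The mean of \<open>tail_influence 0\<close> is eventually at most
    \<open>b * V + 1\<close>, a quarter of \<open>B\<close>.\<close>
  define B where "B = 4 * (b * V + 1)"
  have B: "0 < B" unfolding B_def using b \<open>0 < V\<close> by (simp add: add_nonneg_pos)
  have "AE \<omega> in M. \<forall>\<^sub>F n in sequentially.
    1 / 2 * real n \<le> (\<Sum>t=1..n. indicator (quiet_past B m \<eta> t) \<omega>)"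
    using AE_initial_summable V[unfolded mean_excess_le_def] AE_space
  proof eventually_elim
    case (elim \<omega>)
    have Vn: "\<forall>\<^sub>F n in sequentially. (\<Sum>t=1..n. real (Y (int t) \<omega>)) \<le> V * real n"
      using elim(2) by simp
    have "0 < \<eta> / 8" using assms by simp
    show ?case
      using mean_tail_influence[OF elim(1) Vn zero_less_one, of 0] mean_tail_influence[OF elim(1) Vn \<open>0 < \<eta> / 8\<close>, of m]
    proof eventually_elim
      case (elim n)
      have "real n = (\<Sum>t=1..n. (1::real))" by simp
      also have "\<dots> \<le> (\<Sum>t=1..n. indicator (quiet_past B m \<eta> t) \<omega>
          + tail_influence 0 t \<omega> / B + tail_influence m t \<omega> / \<eta>)"
      proof (rule sum_mono)
        fix t assume t: "t \<in> {1..n}"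
        have nn: "0 \<le> tail_influence 0 t \<omega> / B" "0 \<le> tail_influence m t \<omega> / \<eta>"
          using tail_influence_nonneg[OF \<open>initial_summable \<omega>\<close>] t B assms by auto
        have ind: "0 \<le> (indicator (quiet_past B m \<eta> t) \<omega> :: real)" by simp
        consider "\<omega> \<in> quiet_past B m \<eta> t" | "B < tail_influence 0 t \<omega>" | "\<eta> < tail_influence m t \<omega>"
          using \<open>\<omega> \<in> space M\<close> by (force simp: quiet_past_def)
        then show "1 \<le> indicator (quiet_past B m \<eta> t) \<omega> + tail_influence 0 t \<omega> / B + tail_influence m t \<omega> / \<eta>"
        proof cases
          case 2
          then have "1 \<le> tail_influence 0 t \<omega> / B" using B by simp
          then show ?thesis using nn ind by linarith
        next
          case 3
          then have "1 \<le> tail_influence m t \<omega> / \<eta>" using assms by simp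
          then show ?thesis using nn ind by linarith
        qed (use nn in simp)
      qed
      also have "\<dots> = (\<Sum>t=1..n. indicator (quiet_past B m \<eta> t) \<omega>)
          + (\<Sum>t=1..n. tail_influence 0 t \<omega>) / B + (\<Sum>t=1..n. tail_influence m t \<omega>) / \<eta>"
        by (simp only: sum.distrib sum_divide_distrib)
      also have "(\<Sum>t=1..n. tail_influence 0 t \<omega>) / B \<le> (1 / 4) * real n"
        using elim(1) B by (simp add: B_def b_def pos_divide_le_eq algebra_simps)
      also have "(\<Sum>t=1..n. tail_influence m t \<omega>) / \<eta> \<le> (1 / 4) * real n"
      proof -
        have "(\<Sum>k. \<beta> (Suc k + m)) * V \<le> \<eta> / 8"
          using m(1) \<open>0 < V\<close> by (simp add: field_simps)
        then have "((\<Sum>k. \<beta> (Suc k + m)) * V + \<eta> / 8) * real n \<le> (\<eta> / 4) * real n"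
          by (intro mult_right_mono) auto
        with elim(2) have "(\<Sum>t=1..n. tail_influence m t \<omega>) \<le> (\<eta> / 4) * real n" by linarith
        then show ?thesis using assms by (simp add: pos_divide_le_eq mult.commute)
      qed
      finally show ?case by simp
    qed
  qed
  with B m(2) show ?thesis by blast
qed

text \<open>\<open>p\<close> is read forward in time, from \<open>p 0\<close> at time
  \<open>t\<close>, whereas the first entry of a past is the most recent one.\<close>

definition run :: "(nat \<Rightarrow> 'w set) \<Rightarrow> (nat \<Rightarrow> nat) \<Rightarrow> nat \<Rightarrow> nat \<Rightarrow> 'w set" where
  "run G p j t = {\<omega> \<in> G t. \<forall>i<j. Y (int (t + i)) \<omega> = p i}"

lemma run_sets:
  assumes G: "\<And>t. 1 \<le> t \<Longrightarrow> G t \<in> sets (hist M Y (int t - 1))" and t: "1 \<le> t"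
  shows "run G p j t \<in> sets (hist M Y (int (t + j) - 1))"
proof (induction j)
  case 0
  then show ?case using G[OF t] by (simp add: run_def)
next
  case (Suc j)
  let ?F = "hist M Y (int (t + Suc j) - 1)"
  have "run G p j t \<in> sets ?F" using Suc hist_mono[of "int (t + j) - 1" "int (t + Suc j) - 1"] by auto
  moreover have "Y (int (t + j)) -` {p j} \<inter> space ?F \<in> sets ?F"
    by (rule measurable_sets[OF Y_hist]) auto
  ultimately have "run G p j t \<inter> (Y (int (t + j)) -` {p j} \<inter> space ?F) \<in> sets ?F" by (rule sets.Int)
  also have "run G p j t \<inter> (Y (int (t + j)) -` {p j} \<inter> space ?F) = run G p (Suc j) t"
    using sets.sets_into_space[OF G[OF t]] by (auto simp: run_def less_Suc_eq)
  finally show ?case .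
qed

text \<open>Induction on \<open>j\<close>: after a run of length \<open>j\<close> the rate lies
  between \<open>c\<close> and \<open>L\<close>, so the next prescribed count has conditional
  probability bounded below, and each count costs only a positive factor in the frequency.\<close>

lemma run_frequent:
  assumes G: "\<And>t. 1 \<le> t \<Longrightarrow> G t \<in> sets (hist M Y (int t - 1))"
    and L: "\<And>t j \<omega>. 1 \<le> t \<Longrightarrow> j < m \<Longrightarrow> \<omega> \<in> run G p j t \<Longrightarrow> initial_summable \<omega> \<Longrightarrow> rate (t + j) \<omega> \<le> L"
    and "0 < \<kappa>" and freq: "AE \<omega> in M. \<forall>\<^sub>F n in sequentially. \<kappa> * real n \<le> (\<Sum>t=1..n. indicator (G t) \<omega>)"
    and "j \<le> m"
  shows "\<exists>\<kappa>'>0. AE \<omega> in M. \<forall>\<^sub>F n in sequentially. \<kappa>' * real n \<le> (\<Sum>t=1..n. indicator (run G p j t) \<omega>)"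
  using \<open>j \<le> m\<close>
proof (induction j)
  case 0
  then show ?case using freq \<open>0 < \<kappa>\<close> by (auto simp: run_def)
next
  case (Suc j)
  then obtain \<kappa>' where \<kappa>': "0 < \<kappa>'"
    "AE \<omega> in M. \<forall>\<^sub>F n in sequentially. \<kappa>' * real n \<le> (\<Sum>t=1..n. indicator (run G p j t) \<omega>)"
    by auto
  \<comment> \<open>\<open>L\<close> bounds the rate only where \<open>initial_summable\<close>
    holds. Building the bound into \<open>H\<close> makes it hold everywhere, and off a null set
    \<open>H t\<close> is still the whole run event.\<close>
  define H where "H t = {\<omega> \<in> run G p j t. rate (t + j) \<omega> \<le> L}" for t
  define q where "q = c ^ p j / fact (p j) * exp (- L) * (1 - exp (- 1))"
  have q: "0 < q" unfolding q_def using c_pos by simp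
  define e where "e = q * \<kappa>' / 2"
  have e: "0 < e" using q \<kappa>'(1) by (simp add: e_def)
  have Hs: "H t \<in> sets (hist M Y (int (t + j) - 1))" if t: "1 \<le> t" for t
  proof -
    let ?F = "hist M Y (int (t + j) - 1)"
    have [measurable]: "rate (t + j) \<in> borel_measurable ?F" using rate_measurable t by simp
    have "run G p j t \<inter> {\<omega> \<in> space ?F. rate (t + j) \<omega> \<le> L} \<in> sets ?F"
      by (intro sets.Int run_sets G t) measurable
    also have "run G p j t \<inter> {\<omega> \<in> space ?F. rate (t + j) \<omega> \<le> L} = H t"
      using sets.sets_into_space[OF G[OF t]] by (auto simp: H_def run_def)
    finally show ?thesis .
  qed
  have "AE \<omega> in M. \<forall>\<^sub>F n in sequentially. q * (\<Sum>t=1..n. indicator (H t) \<omega>)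
      \<le> (\<Sum>t=1..n. indicator (H t) \<omega> * (if Y (int (t + j)) \<omega> = p j then 1 else 0)) + e * real n"
    unfolding q_def
    by (rule frequency_bound[OF Hs c_pos _ e]) (use c_le[OF \<theta>s past_space] in \<open>auto simp: H_def\<close>)
  then have "AE \<omega> in M. \<forall>\<^sub>F n in sequentially. e * real n \<le> (\<Sum>t=1..n. indicator (run G p (Suc j) t) \<omega>)"
    using \<kappa>'(2) AE_initial_summable
  proof eventually_elim
    case (elim \<omega>)
    have eq: "indicator (H t) \<omega> = (indicator (run G p j t) \<omega> :: real)" if "1 \<le> t" for t
      using L[OF that, of j \<omega>] Suc.prems elim(3) by (auto simp: H_def indicator_def)
    show ?case using elim(1,2)
    proof eventually_elim
      case (elim n)
      have "q * (\<kappa>' * real n) \<le> q * (\<Sum>t=1..n. indicator (H t) \<omega>)"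
        using elim(2) q by (intro mult_left_mono) (auto simp: eq)
      also have "\<dots> \<le> (\<Sum>t=1..n. indicator (H t) \<omega> * (if Y (int (t + j)) \<omega> = p j then 1 else 0)) + e * real n"
        by (rule elim(1))
      also have "(\<Sum>t=1..n. indicator (H t) \<omega> * (if Y (int (t + j)) \<omega> = p j then 1 else 0))
          = (\<Sum>t=1..n. indicator (run G p (Suc j) t) \<omega> :: real)"
      proof (rule sum.cong[OF refl])
        fix t assume "t \<in> {1..n}"
        then have "indicator (H t) \<omega> = (indicator (run G p j t) \<omega> :: real)" by (intro eq) simp
        then show "indicator (H t) \<omega> * (if Y (int (t + j)) \<omega> = p j then 1 else 0)
          = (indicator (run G p (Suc j) t) \<omega> :: real)"
          by (auto simp: run_def less_Suc_eq split: split_indicator)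
      qed
      finally show ?case by (simp add: e_def)
    qed
  qed
  with e show ?case by blast
qed

section \<open>Separation from the true parameter\<close>

text \<open>Where \<open>initial_summable\<close> holds, both intensities at the past of time 1 are
  limits of their values at its truncations, which are finitely supported patterns. Agreement on all
  such patterns would therefore give agreement almost surely.\<close>

lemma distinguishing_pattern:
  assumes \<theta>: "\<theta> \<in> \<Theta>" and ne: "\<not> (AE \<omega> in M. f \<theta> (past Y 1 \<omega>) = f \<theta>s (past Y 1 \<omega>))"
  shows "\<exists>q m. (\<forall>k\<ge>m. q k = 0) \<and> f \<theta> (pattern_seq q) \<noteq> f \<theta>s (pattern_seq q)"
proof (rule ccontr)
  assume "\<not> ?thesis"
  then have eq: "f \<theta> (pattern_seq q) = f \<theta>s (pattern_seq q)" if "\<forall>k\<ge>m. q k = 0" for q m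
    using that by blast
  have "AE \<omega> in M. f \<theta> (past Y 1 \<omega>) = f \<theta>s (past Y 1 \<omega>)"
    using AE_initial_summable
  proof eventually_elim
    case (elim \<omega>)
    let ?g = "\<lambda>s. \<beta> (Suc s) * real (Y (- int s) \<omega>)"
    have near: "\<bar>f \<theta>' (past Y 1 \<omega>) - f \<theta>' (truncate_seq (Suc j) (past Y 1 \<omega>))\<bar> \<le> (\<Sum>s. ?g (s + j))"
      if "\<theta>' \<in> \<Theta>" for \<theta>' j
    proof -
      let ?b = "\<lambda>k. if k < j then 0 else ?g k"
      have sh: "(\<lambda>k. ?b (k + j)) = (\<lambda>k. ?g (k + j))" by auto
      have "summable (\<lambda>k. ?b (k + j))" unfolding sh by (rule summable_ignore_initial_segment[OF elim])
      then have sb: "summable ?b" by (rule summable_iff_shift[of ?b j, THEN iffD1])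
      have "\<bar>f \<theta>' (past Y 1 \<omega>) - f \<theta>' (truncate_seq (Suc j) (past Y 1 \<omega>))\<bar> \<le> suminf ?b"
        using that past_space truncate_seq_space[OF past_space]
        by (rule lip_dominated[OF _ _ _ _ sb]) (auto intro!: mult_right_mono \<alpha>_le_\<beta>)
      also have "suminf ?b = (\<Sum>k. ?b (k + j)) + (\<Sum>i<j. ?b i)"
        by (rule suminf_split_initial_segment[OF sb])
      also have "(\<Sum>i<j. ?b i) = 0" by (rule sum.neutral) auto
      finally show ?thesis unfolding sh by simp
    qed
    have "\<bar>f \<theta> (past Y 1 \<omega>) - f \<theta>s (past Y 1 \<omega>)\<bar> \<le> 0 + e" if e: "0 < e" for e
    proof -
      obtain j where j: "norm (\<Sum>s. ?g (s + j)) < e / 2"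
        using suminf_exist_split[OF _ elim, of "e / 2"] e by (auto simp del: real_norm_def)
      have "f \<theta> (truncate_seq (Suc j) (past Y 1 \<omega>)) = f \<theta>s (truncate_seq (Suc j) (past Y 1 \<omega>))"
        unfolding truncate_past by (rule eq[of "Suc j"]) simp
      then show ?thesis
        using near[OF \<theta>, of j] near[OF \<theta>s, of j] j by auto
    qed
    then have "\<bar>f \<theta> (past Y 1 \<omega>) - f \<theta>s (past Y 1 \<omega>)\<bar> \<le> 0" by (rule field_le_epsilon)
    then show ?case by simp
  qed
  with ne show False by blast
qed

text \<open>When the distinguishing pattern is completed after a quiet past, the true rate is close
  to \<open>f \<theta>s z\<close> and the intensity at \<open>\<theta>\<close> close to
  \<open>f \<theta> z\<close>, so their roots differ by a fixed amount. By
  \<open>run_frequent\<close> this happens at a positive fraction of times.\<close>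

lemma hellinger_separation:
  assumes \<theta>: "\<theta> \<in> \<Theta>" and ne: "\<not> (AE \<omega> in M. f \<theta> (past Y 1 \<omega>) = f \<theta>s (past Y 1 \<omega>))"
  shows "\<exists>\<delta>>0. AE \<omega> in M. \<forall>\<^sub>F n in sequentially. \<delta> * real n
     \<le> (\<Sum>t=1..n. (sqrt (f \<theta> (observed_past Y (int t) \<omega>)) - sqrt (rate t \<omega>))\<^sup>2)"
proof -
  obtain q m0 where q: "\<And>k. m0 \<le> k \<Longrightarrow> q k = 0" and fq: "f \<theta> (pattern_seq q) \<noteq> f \<theta>s (pattern_seq q)"
    using distinguishing_pattern[OF assms] by blast
  define z where "z = pattern_seq q"
  define \<Delta> where "\<Delta> = \<bar>f \<theta> z - f \<theta>s z\<bar>"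
  have \<Delta>: "0 < \<Delta>" using fq by (simp add: \<Delta>_def z_def)
  then have "0 < \<Delta> / 8" by simp
  from quiet_past_frequent[OF this, of m0] obtain B m where B: "0 < B" and m: "m0 \<le> m"
    and freq: "AE \<omega> in M. \<forall>\<^sub>F n in sequentially.
      1 / 2 * real n \<le> (\<Sum>t=1..n. indicator (quiet_past B m (\<Delta> / 8) t) \<omega>)"
    by blast
  define G where "G = quiet_past B m (\<Delta> / 8)"
  \<comment> \<open>Time \<open>t + i\<close> is lag \<open>m - i\<close> as seen from time
    \<open>t + m\<close>.\<close>
  define p where "p = (\<lambda>i. q (m - i))"
  define Q where "Q = (\<Sum>k\<le>m. q k)"
  \<comment> \<open>\<open>F\<close> accounts for the zero sequence, the sum for the counts of the
    run, which are at most \<open>Q\<close>, and \<open>B\<close> for everything before time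
    \<open>t\<close>.\<close>
  define L where "L = F + (\<Sum>k=1..<Suc m. \<alpha> k * real Q) + B"
  have L: "rate (t + j) \<omega> \<le> L" if t: "1 \<le> t" and j: "j < m" and \<omega>: "\<omega> \<in> run G p j t" and s: "initial_summable \<omega>" for t j \<omega>
  proof -
    have "rate (t + j) \<omega> \<le> f \<theta>s (truncate_seq (Suc j) (past Y (int (t + j)) \<omega>)) + tail_influence j t \<omega>"
      using past_truncate_diff[OF s t \<theta>s, of j] by simp
    also have "tail_influence j t \<omega> \<le> B"
      using tail_influence_antimono[of 0 j t \<omega>] \<omega> by (auto simp: run_def G_def quiet_past_def)
    also have "\<bar>f \<theta>s (truncate_seq (Suc j) (past Y (int (t + j)) \<omega>)) - f \<theta>s zero_seq\<bar>
        \<le> (\<Sum>k=1..<Suc m. \<alpha> k * real Q)"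
    proof (rule lip_finite[OF \<theta>s truncate_seq_space[OF past_space] zero_seq_space])
      fix k assume k: "1 \<le> k" "k < Suc m"
      have "Y (int (t + j) - int k) \<omega> \<le> Q" if "k \<le> j"
      proof -
        have "\<forall>i<j. Y (int (t + i)) \<omega> = q (m - i)" using \<omega> by (simp add: run_def p_def)
        moreover have "j - k < j" using k(1) that by simp
        ultimately have "Y (int (t + (j - k))) \<omega> = q (m - (j - k))" by blast
        also have "\<dots> \<le> Q" unfolding Q_def by (rule member_le_sum) auto
        finally show ?thesis using that by (simp add: of_nat_diff algebra_simps)
      qed
      then show "\<alpha> k * \<bar>truncate_seq (Suc j) (past Y (int (t + j)) \<omega>) k - zero_seq k\<bar> \<le> \<alpha> k * real Q"
        using k by (intro mult_left_mono \<alpha>_nonneg) (auto simp: truncate_seq_def past_def zero_seq_def)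
    qed (use j in \<open>auto simp: truncate_seq_def zero_seq_def\<close>)
    then have "f \<theta>s (truncate_seq (Suc j) (past Y (int (t + j)) \<omega>))
        \<le> F + (\<Sum>k=1..<Suc m. \<alpha> k * real Q)"
      using F_ge[OF \<theta>s] by linarith
    finally show ?thesis by (simp add: L_def)
  qed
  have "\<exists>\<kappa>>0. AE \<omega> in M. \<forall>\<^sub>F n in sequentially. \<kappa> * real n \<le> (\<Sum>t=1..n. indicator (run G p m t) \<omega>)"
    by (rule run_frequent[where \<kappa> = "1 / 2" and L = L and m = m])
       (use L freq in \<open>auto simp: G_def intro!: quiet_past_sets\<close>)
  then obtain \<kappa> where \<kappa>: "0 < \<kappa>"
    "AE \<omega> in M. \<forall>\<^sub>F n in sequentially. \<kappa> * real n \<le> (\<Sum>t=1..n. indicator (run G p m t) \<omega>)" by blast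
  define U where "U = f \<theta> z + f \<theta>s z + \<Delta>"
  have zpos: "0 < f \<theta> z" "0 < f \<theta>s z"
    using c_le[OF \<theta>, of z] c_le[OF \<theta>s, of z] c_pos by (simp_all add: z_def)
  then have U: "0 < U" using \<Delta> by (simp add: U_def)
  define D where "D t \<omega> = (sqrt (f \<theta> (observed_past Y (int t) \<omega>)) - sqrt (rate t \<omega>))\<^sup>2" for t \<omega>
  define d where "d = (\<Delta> / 2)\<^sup>2 / (4 * U)"
  have d: "0 < d" using U \<Delta> by (simp add: d_def)
  have sep: "d * indicator (run G p m t) \<omega> \<le> D (t + m) \<omega>" if t: "1 \<le> t" and s: "initial_summable \<omega>" for t \<omega>
  proof (cases "\<omega> \<in> run G p m t")
    case True
    have tr: "truncate_seq (Suc m) (past Y (int (t + m)) \<omega>) = z"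
    proof -
      \<comment> \<open>The run fixes lags 1 to \<open>m\<close>; at larger lags \<open>q\<close> is
        0 because \<open>m0 \<le> m\<close>.\<close>
      have "(if k < Suc m then Y (int (t + m) - int k) \<omega> else 0) = q k" if k: "1 \<le> k" for k
      proof (cases "k \<le> m")
        case km: True
        have "\<forall>i<m. Y (int (t + i)) \<omega> = q (m - i)" using True by (simp add: run_def p_def)
        moreover have "m - k < m" using k km by simp
        ultimately have "Y (int (t + (m - k))) \<omega> = q (m - (m - k))" by blast
        then show ?thesis using km by (simp add: of_nat_diff algebra_simps)
      qed (use m q in auto)
      then show ?thesis unfolding truncate_past z_def pattern_seq_def by (auto simp: restrict_def)
    qed
    have ti: "tail_influence m t \<omega> \<le> \<Delta> / 8" using True by (auto simp: run_def G_def quiet_past_def)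
    have r: "remote (t + m) \<omega> \<le> \<Delta> / 8"
      using remote_antimono[OF s t, of m] remote_le_tail_influence[of t \<omega> m] ti by linarith
    have 1: "\<bar>rate (t + m) \<omega> - f \<theta>s z\<bar> \<le> \<Delta> / 8"
      using past_truncate_diff[OF s t \<theta>s, of m] ti unfolding tr by linarith
    have 2: "\<bar>f \<theta> (observed_past Y (int (t + m)) \<omega>) - f \<theta> z\<bar> \<le> \<Delta> / 8 + \<Delta> / 8"
      using past_truncate_diff[OF s t \<theta>, of m] past_observed_diff[OF s _ \<theta>, of "t + m"] t ti r unfolding tr by linarith
    have "d \<le> D (t + m) \<omega>"
      unfolding d_def D_def
    proof (rule sqrt_diff_ge)
      show "0 \<le> f \<theta> (observed_past Y (int (t + m)) \<omega>)" "0 \<le> rate (t + m) \<omega>"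
        using c_le[OF \<theta> observed_past_space] c_le[OF \<theta>s past_space] c_pos order_trans less_imp_le by metis+
      show "f \<theta> (observed_past Y (int (t + m)) \<omega>) \<le> U" "rate (t + m) \<omega> \<le> U"
        unfolding U_def using 1 2 \<Delta> zpos by linarith+
      show "\<Delta> / 2 \<le> \<bar>f \<theta> (observed_past Y (int (t + m)) \<omega>) - rate (t + m) \<omega>\<bar>"
      proof -
        have "\<Delta> \<le> \<bar>f \<theta> (observed_past Y (int (t + m)) \<omega>) - f \<theta> z\<bar>
            + \<bar>f \<theta> (observed_past Y (int (t + m)) \<omega>) - rate (t + m) \<omega>\<bar> + \<bar>rate (t + m) \<omega> - f \<theta>s z\<bar>"
          unfolding \<Delta>_def by linarith
        then show ?thesis using 1 2 \<Delta> by linarith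
      qed
    qed (use U \<Delta> in auto)
    then show ?thesis using True by simp
  qed (simp add: D_def)
  have "AE \<omega> in M. \<forall>\<^sub>F n in sequentially. (d * \<kappa> / 2) * real n \<le> (\<Sum>t=1..n. D t \<omega>)"
    using \<kappa>(2) AE_initial_summable
  proof eventually_elim
    case (elim \<omega>)
    have "\<forall>\<^sub>F n in sequentially. \<kappa> * real (n - m) \<le> (\<Sum>t=1..n-m. indicator (run G p m t) \<omega>)"
      using elim(1) by (rule eventually_compose_filterlim[OF _ filterlim_minus_const_nat_at_top])
    \<comment> \<open>Starting times up to \<open>n - m\<close> keep \<open>t + m\<close> within
      \<open>n\<close>, and \<open>2 * m \<le> n\<close> makes \<open>n - m\<close> at least half of
      \<open>n\<close>.\<close>
    then show ?case using eventually_ge_at_top[of "2 * m"]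
    proof eventually_elim
      case e: (elim n)
      have "(d * \<kappa> / 2) * real n \<le> d * (\<kappa> * real (n - m))"
        using e(2) d \<kappa>(1) by (simp add: of_nat_diff)
      also have "\<dots> \<le> d * (\<Sum>t=1..n-m. indicator (run G p m t) \<omega>)"
        using e(1) d by (intro mult_left_mono) auto
      also have "\<dots> \<le> (\<Sum>t=1..n-m. D (t + m) \<omega>)"
        unfolding sum_distrib_left using elim(2) by (intro sum_mono sep) auto
      also have "\<dots> = (\<Sum>t\<in>(\<lambda>t. t + m) ` {1..n-m}. D t \<omega>)"
        by (subst sum.reindex) auto
      also have "\<dots> \<le> (\<Sum>t=1..n. D t \<omega>)"
        using e(2) by (intro sum_mono2) (auto simp: D_def)
      finally show ?case .
    qed
  qed
  moreover have "0 < d * \<kappa> / 2" using d \<kappa>(1) by simp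
  ultimately show ?thesis unfolding D_def by blast
qed

section \<open>Comparison of likelihoods and consistency\<close>

text \<open>A predictable bound, free of the parameter, for the change of intensity over a small
  ball: \<open>\<eta>\<close> for the cut and capped pattern, then the excesses above
  \<open>b\<close> and the lags beyond \<open>m\<close>. The factors 2 arise because the cut is made
  at two parameters.\<close>

definition oscillation :: "real \<Rightarrow> nat \<Rightarrow> nat \<Rightarrow> nat \<Rightarrow> 'w \<Rightarrow> real" where
  "oscillation \<eta> b m t \<omega> = \<eta> + 2 * (\<Sum>k=1..<t. \<alpha> k * max 0 (real (Y (int (t - k)) \<omega>) - real b))
     + 2 * (\<Sum>k=1..<t. (if m < k then \<alpha> k else 0) * real (Y (int (t - k)) \<omega>))"

lemma oscillation_measurable [measurable]:
  assumes "1 \<le> t"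
  shows "oscillation \<eta> b m t \<in> borel_measurable (hist M Y (int t - 1))"
proof -
  have "(\<lambda>\<omega>. real (Y (int (t - k)) \<omega>)) \<in> borel_measurable (hist M Y (int t - 1))" if "k \<in> {1..<t}" for k
    using that by (intro measurable_compose[OF Y_hist]) auto
  then show ?thesis
    unfolding oscillation_def by (intro borel_measurable_add borel_measurable_times borel_measurable_sum
       borel_measurable_max borel_measurable_diff borel_measurable_const)
qed

lemma oscillation_ge: "\<eta> \<le> oscillation \<eta> b m t \<omega>"
proof -
  have "0 \<le> (\<Sum>k=1..<t. \<alpha> k * max 0 (real (Y (int (t - k)) \<omega>) - real b))"
    by (intro sum_nonneg mult_nonneg_nonneg \<alpha>_nonneg) auto
  moreover have "0 \<le> (\<Sum>k=1..<t. (if m < k then \<alpha> k else 0) * real (Y (int (t - k)) \<omega>))"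
    by (intro sum_nonneg mult_nonneg_nonneg) (auto simp: \<alpha>_nonneg)
  ultimately show ?thesis by (simp add: oscillation_def)
qed

text \<open>Only finitely many patterns arise from observed pasts by cutting them at lag \<open>m\<close> and capping them at \<open>b\<close>,
  so pointwise continuity in the parameter is uniform over them.\<close>

lemma oscillation_bound:
  assumes \<theta>0: "\<theta>0 \<in> \<Theta>" and "0 < \<eta>"
  shows "\<exists>\<epsilon>>0. \<forall>\<theta>\<in>\<Theta>. dist \<theta> \<theta>0 < \<epsilon> \<longrightarrow> (\<forall>t \<omega>.
    \<bar>f \<theta> (observed_past Y (int t) \<omega>) - f \<theta>0 (observed_past Y (int t) \<omega>)\<bar> \<le> oscillation \<eta> b m t \<omega>)"
proof -
  define Q :: "(nat \<Rightarrow> nat) set" where "Q = {q. \<forall>k. (k \<in> {..m} \<longrightarrow> q k \<in> {..b}) \<and> (k \<notin> {..m} \<longrightarrow> q k = 0)}"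
  have "finite Q" unfolding Q_def by (rule finite_set_of_finite_funs) auto
  moreover have "\<forall>\<^sub>F \<theta> in at \<theta>0 within \<Theta>. dist (f \<theta> (pattern_seq q)) (f \<theta>0 (pattern_seq q)) < \<eta>" for q
    using f_cont[OF pattern_seq_space, of q] \<theta>0 \<open>0 < \<eta>\<close>
    unfolding continuous_on_def by (auto intro: tendstoD)
  ultimately have "\<forall>\<^sub>F \<theta> in at \<theta>0 within \<Theta>. \<forall>q\<in>Q. dist (f \<theta> (pattern_seq q)) (f \<theta>0 (pattern_seq q)) < \<eta>"
    by (intro eventually_ball_finite) auto
  then obtain \<epsilon> where \<epsilon>: "0 < \<epsilon>" and near: "\<And>\<theta> q. \<theta> \<in> \<Theta> \<Longrightarrow> \<theta> \<noteq> \<theta>0 \<Longrightarrow> dist \<theta> \<theta>0 < \<epsilon> \<Longrightarrow> q \<in> Q \<Longrightarrow>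
      dist (f \<theta> (pattern_seq q)) (f \<theta>0 (pattern_seq q)) < \<eta>"
    unfolding eventually_at by blast
  show ?thesis
  proof (intro exI[of _ \<epsilon>] conjI ballI impI allI)
    fix \<theta> t \<omega> assume \<theta>: "\<theta> \<in> \<Theta>" "dist \<theta> \<theta>0 < \<epsilon>"
    define q where "q k = (if 1 \<le> k \<and> k \<le> m \<and> k < t then min b (Y (int (t - k)) \<omega>) else 0)" for k
    let ?o = "observed_past Y (int t) \<omega>"
    have "q \<in> Q" by (auto simp: Q_def q_def)
    have mid: "\<bar>f \<theta> (pattern_seq q) - f \<theta>0 (pattern_seq q)\<bar> \<le> \<eta>"
    proof (cases "\<theta> = \<theta>0")
      case False
      then show ?thesis using near[OF \<theta>(1) False \<theta>(2) \<open>q \<in> Q\<close>] by (simp add: dist_real_def)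
    qed (use \<open>0 < \<eta>\<close> in simp)
    have cut: "\<bar>f \<theta>' ?o - f \<theta>' (pattern_seq q)\<bar>
        \<le> (\<Sum>k=1..<t. \<alpha> k * max 0 (real (Y (int (t - k)) \<omega>) - real b))
         + (\<Sum>k=1..<t. (if m < k then \<alpha> k else 0) * real (Y (int (t - k)) \<omega>))" if "\<theta>' \<in> \<Theta>" for \<theta>'
      unfolding sum.distrib[symmetric] using that observed_past_space pattern_seq_space
    proof (rule lip_finite)
      fix k assume k: "1 \<le> k" "k < t"
      have o: "?o k = real (Y (int (t - k)) \<omega>)" "pattern_seq q k = real (q k)"
        using k by (auto simp: observed_past_def pattern_seq_def of_nat_diff)
      show "\<alpha> k * \<bar>?o k - pattern_seq q k\<bar> \<le> \<alpha> k * max 0 (real (Y (int (t - k)) \<omega>) - real b)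
          + (if m < k then \<alpha> k else 0) * real (Y (int (t - k)) \<omega>)"
      proof (cases "m < k")
        case True
        then show ?thesis using k \<alpha>_nonneg[OF k(1)] unfolding o by (simp add: q_def)
      next
        case False
        then have "\<bar>real (Y (int (t - k)) \<omega>) - real (q k)\<bar> = max 0 (real (Y (int (t - k)) \<omega>) - real b)"
          using k by (auto simp: q_def min_def max_def)
        then show ?thesis using False unfolding o by simp
      qed
    qed (auto simp: observed_past_def pattern_seq_def q_def)
    show "\<bar>f \<theta> ?o - f \<theta>0 ?o\<bar> \<le> oscillation \<eta> b m t \<omega>"
      using mid cut[OF \<theta>(1)] cut[OF \<theta>0] unfolding oscillation_def by linarith
  qed fact
qed

text \<open>\<open>b\<close> comes from \<open>mean_excess_small\<close> and \<open>m\<close> from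
  the tail of \<open>\<alpha>\<close>. Each double sum has mean at most \<open>\<eta> / 2\<close>
  and is doubled, which with the constant \<open>\<eta>\<close> gives
  \<open>3 * \<eta>\<close>.\<close>

lemma mean_oscillation_small:
  assumes "0 < \<eta>"
  shows "\<exists>b m. AE \<omega> in M. \<forall>\<^sub>F n in sequentially. (\<Sum>t=1..n. oscillation \<eta> b m t \<omega>) \<le> 3 * \<eta> * real n"
proof -
  obtain V where "0 < V" and V: "mean_excess_le 0 V" using mean_le by blast
  obtain B where B: "0 \<le> B" "mean_excess_le B (\<eta> / 2)" using mean_excess_small[of "\<eta> / 2"] assms by auto
  obtain b :: nat where b: "B \<le> real b" using real_arch_simple by blast
  obtain m where m: "norm (\<Sum>k. \<alpha> (Suc (k + m))) < \<eta> / (2 * V)"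
    using suminf_exist_split[OF _ \<alpha>_summable, of "\<eta> / (2 * V)"] assms \<open>0 < V\<close> by (auto simp del: real_norm_def)
  define A where "A = (\<Sum>k. if m < Suc k then \<alpha> (Suc k) else 0)"
  have sA: "summable (\<lambda>k. if m < Suc k then \<alpha> (Suc k) else 0)"
    by (rule summable_comparison_test'[OF \<alpha>_summable, where N=0]) (simp add: \<alpha>_nonneg)
  have "A = (\<Sum>k. if m < Suc (k + m) then \<alpha> (Suc (k + m)) else 0) + (\<Sum>i<m. if m < Suc i then \<alpha> (Suc i) else 0)"
    unfolding A_def by (rule suminf_split_initial_segment[OF sA])
  also have "(\<Sum>i<m. if m < Suc i then \<alpha> (Suc i) else 0) = 0" by (rule sum.neutral) auto
  finally have "A < \<eta> / (2 * V)" using m by simp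
  then have AV: "A * V \<le> \<eta> / 2" using \<open>0 < V\<close> by (simp add: field_simps)
  have A0: "0 \<le> A" unfolding A_def by (intro suminf_nonneg sA) (simp add: \<alpha>_nonneg)
  have "AE \<omega> in M. \<forall>\<^sub>F n in sequentially. (\<Sum>t=1..n. oscillation \<eta> b m t \<omega>) \<le> 3 * \<eta> * real n"
    using V[unfolded mean_excess_le_def] B(2)[unfolded mean_excess_le_def]
  proof eventually_elim
    case (elim \<omega>)
    then show ?case
    proof eventually_elim
      case (elim n)
      have "(\<Sum>t=1..n. \<Sum>k=1..<t. \<alpha> k * max 0 (real (Y (int (t - k)) \<omega>) - real b))
         \<le> a * (\<Sum>t=1..n. max 0 (real (Y (int t) \<omega>) - real b))"
        unfolding a_def
        by (rule sum_convolution_le[where u = "\<lambda>s. max 0 (real (Y (int s) \<omega>) - real b)"]) (auto simp: \<alpha>_nonneg \<alpha>_summable)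
      also have "\<dots> \<le> 1 * (\<Sum>t=1..n. max 0 (real (Y (int t) \<omega>) - B))"
        using a_bounds b by (intro mult_mono sum_mono sum_nonneg) auto
      also have "\<dots> \<le> \<eta> / 2 * real n" using elim(2) by simp
      finally have 1: "(\<Sum>t=1..n. \<Sum>k=1..<t. \<alpha> k * max 0 (real (Y (int (t - k)) \<omega>) - real b)) \<le> \<eta> / 2 * real n" .
      have "(\<Sum>t=1..n. \<Sum>k=1..<t. (if m < k then \<alpha> k else 0) * real (Y (int (t - k)) \<omega>))
         \<le> A * (\<Sum>t=1..n. real (Y (int t) \<omega>))"
        unfolding A_def
        by (rule sum_convolution_le[where b = "\<lambda>k. if m < k then \<alpha> k else 0" and u = "\<lambda>s. real (Y (int s) \<omega>)"])
           (use sA in \<open>auto simp: \<alpha>_nonneg\<close>)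
      also have "\<dots> \<le> A * (V * real n)" using elim(1) A0 by (intro mult_left_mono) auto
      also have "\<dots> = (A * V) * real n" by simp
      also have "\<dots> \<le> \<eta> / 2 * real n" using AV by (rule mult_right_mono) simp
      finally have 2: "(\<Sum>t=1..n. \<Sum>k=1..<t. (if m < k then \<alpha> k else 0) * real (Y (int (t - k)) \<omega>)) \<le> \<eta> / 2 * real n" .
      have "(\<Sum>t=1..n. oscillation \<eta> b m t \<omega>) = \<eta> * real n
          + 2 * (\<Sum>t=1..n. \<Sum>k=1..<t. \<alpha> k * max 0 (real (Y (int (t - k)) \<omega>) - real b))
          + 2 * (\<Sum>t=1..n. \<Sum>k=1..<t. (if m < k then \<alpha> k else 0) * real (Y (int (t - k)) \<omega>))"
        unfolding oscillation_def sum.distrib sum_distrib_left[symmetric] by simp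
      with 1 2 show ?case by (simp add: algebra_simps)
    qed
  qed
  then show ?thesis by blast
qed

section \<open>Comparison of likelihoods and Wald's argument\<close>

definition likelihood :: "nat \<Rightarrow> 'p \<Rightarrow> 'w \<Rightarrow> real" where
  "likelihood n \<theta> \<omega> = (\<Sum>t=1..n. real (Y (int t) \<omega>) * ln (f \<theta> (observed_past Y (int t) \<omega>))
      - f \<theta> (observed_past Y (int t) \<omega>))"

text \<open>The majorant \<open>h\<close> depends on the ball but not on the parameter in it, so one
  application of \<open>hellinger_bound\<close> serves uncountably many parameters at once. It
  remains to see that the Hellinger gain exceeds the errors.\<close>

lemma likelihood_separation:
  assumes \<theta>0: "\<theta>0 \<in> \<Theta>" and ne: "\<not> (AE \<omega> in M. f \<theta>0 (past Y 1 \<omega>) = f \<theta>s (past Y 1 \<omega>))"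
  shows "\<exists>\<epsilon>>0. AE \<omega> in M. \<forall>\<^sub>F n in sequentially. \<forall>\<theta>\<in>\<Theta>. dist \<theta> \<theta>0 < \<epsilon> \<longrightarrow>
     likelihood n \<theta> \<omega> < likelihood n \<theta>s \<omega>"
proof -
  obtain \<delta> where \<delta>: "0 < \<delta>" and sep: "AE \<omega> in M. \<forall>\<^sub>F n in sequentially. \<delta> * real n
     \<le> (\<Sum>t=1..n. (sqrt (f \<theta>0 (observed_past Y (int t) \<omega>)) - sqrt (rate t \<omega>))\<^sup>2)"
    using hellinger_separation[OF assms] by blast
  \<comment> \<open>In units of \<open>\<delta> / 36\<close> per observation the gain is 18; the
    errors are 2 from \<open>X\<close>, 9 from the oscillation and 2 from the unobserved past, which
    leaves 5.\<close>
  define \<eta> where "\<eta> = \<delta> / 36"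
  have \<eta>: "0 < \<eta>" using \<delta> by (simp add: \<eta>_def)
  obtain b m where osc: "AE \<omega> in M. \<forall>\<^sub>F n in sequentially. (\<Sum>t=1..n. oscillation \<eta> b m t \<omega>) \<le> 3 * \<eta> * real n"
    using mean_oscillation_small[OF \<eta>] by blast
  obtain \<epsilon> where \<epsilon>: "0 < \<epsilon>" and near: "\<And>\<theta> t \<omega>. \<theta> \<in> \<Theta> \<Longrightarrow> dist \<theta> \<theta>0 < \<epsilon> \<Longrightarrow>
      \<bar>f \<theta> (observed_past Y (int t) \<omega>) - f \<theta>0 (observed_past Y (int t) \<omega>)\<bar> \<le> oscillation \<eta> b m t \<omega>"
    using oscillation_bound[OF \<theta>0 \<eta>, of b m] by blast
  obtain V where V: "mean_excess_le 0 V" using mean_le by blast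
  define g where "g t \<omega> = f \<theta>0 (observed_past Y (int t) \<omega>)" for t \<omega>
  define h where "h t \<omega> = g t \<omega> + oscillation \<eta> b m t \<omega>" for t \<omega>
  have hm: "h t \<in> borel_measurable (hist M Y (int t - 1))" if "1 \<le> t" for t
    unfolding h_def g_def
    by (intro borel_measurable_add oscillation_measurable that
        measurable_compose[OF observed_past_measurable f_measurable[OF \<theta>0]])
  have hpos: "0 < h t \<omega>" for t \<omega>
    using c_le[OF \<theta>0 observed_past_space, of Y "int t" \<omega>] c_pos \<eta> oscillation_ge[of \<eta> b m t \<omega>]
    by (simp add: h_def g_def)
  define X where "X t \<omega> = real (Y (int t) \<omega>) * ln (h t \<omega> / rate t \<omega>) / 2 - sqrt (rate t \<omega> * h t \<omega>) + rate t \<omega>"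
    for t \<omega>
  have hell: "AE \<omega> in M. \<forall>\<^sub>F n in sequentially. (\<Sum>t=1..n. X t \<omega>) \<le> (\<delta> / 36) * real n"
    unfolding X_def using \<delta> by (intro hellinger_bound hm hpos) auto
  have "AE \<omega> in M. \<forall>\<^sub>F n in sequentially. \<forall>\<theta>\<in>\<Theta>. dist \<theta> \<theta>0 < \<epsilon> \<longrightarrow>
     likelihood n \<theta> \<omega> < likelihood n \<theta>s \<omega>"
    using sep osc hell V[unfolded mean_excess_le_def] AE_initial_summable
  proof eventually_elim
    case (elim \<omega>)
    have Vn: "\<forall>\<^sub>F n in sequentially. (\<Sum>t=1..n. real (Y (int t) \<omega>)) \<le> V * real n"
      using elim(4) by simp
    \<comment> \<open>The factor \<open>c\<close> anticipates the division by \<open>c\<close> in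
      \<open>log_likelihood_term_le\<close>.\<close>
    have yr: "\<forall>\<^sub>F n in sequentially. (\<Sum>t=1..n. real (Y (int t) \<omega>) * remote t \<omega>) \<le> (c * \<delta> / 36) * real n"
      using c_pos \<delta> by (intro sum_mult_null_le[OF remote_tendsto_0[OF elim(5)] _ Vn]) auto
    have r: "\<forall>\<^sub>F n in sequentially. (\<Sum>t=1..n. remote t \<omega>) \<le> (\<delta> / 36) * real n"
      using \<delta> by (intro sum_remote_le[OF elim(5)]) auto
    show ?case
      using elim(1,2,3) yr r eventually_gt_at_top[of 0]
    proof eventually_elim
      case e: (elim n)
      show ?case
      proof (intro ballI impI)
        fix \<theta> assume \<theta>: "\<theta> \<in> \<Theta>" "dist \<theta> \<theta>0 < \<epsilon>"
        have "likelihood n \<theta> \<omega> - likelihood n \<theta>s \<omega> =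
          (\<Sum>t=1..n. (real (Y (int t) \<omega>) * ln (f \<theta> (observed_past Y (int t) \<omega>)) - f \<theta> (observed_past Y (int t) \<omega>))
           - (real (Y (int t) \<omega>) * ln (f \<theta>s (observed_past Y (int t) \<omega>)) - f \<theta>s (observed_past Y (int t) \<omega>)))"
          unfolding likelihood_def by (rule sum_subtractf[symmetric])
        also have "\<dots> \<le> (\<Sum>t=1..n. 2 * X t \<omega> - (sqrt (g t \<omega>) - sqrt (rate t \<omega>))\<^sup>2 / 2
            + (3 * oscillation \<eta> b m t \<omega> + (real (Y (int t) \<omega>) * remote t \<omega> / c + remote t \<omega>)))"
        proof (rule sum_mono)
          fix t assume t: "t \<in> {1..n}"
          show "(real (Y (int t) \<omega>) * ln (f \<theta> (observed_past Y (int t) \<omega>)) - f \<theta> (observed_past Y (int t) \<omega>))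
           - (real (Y (int t) \<omega>) * ln (f \<theta>s (observed_past Y (int t) \<omega>)) - f \<theta>s (observed_past Y (int t) \<omega>))
           \<le> 2 * X t \<omega> - (sqrt (g t \<omega>) - sqrt (rate t \<omega>))\<^sup>2 / 2
            + (3 * oscillation \<eta> b m t \<omega> + (real (Y (int t) \<omega>) * remote t \<omega> / c + remote t \<omega>))"
            unfolding X_def h_def g_def
            using t \<theta> \<theta>0 \<theta>s c_pos near past_observed_diff[OF elim(5)]
            by (intro log_likelihood_term_le c_le observed_past_space past_space) auto
        qed
        also have "\<dots> = 2 * (\<Sum>t=1..n. X t \<omega>) - (\<Sum>t=1..n. (sqrt (g t \<omega>) - sqrt (rate t \<omega>))\<^sup>2) / 2
           + (3 * (\<Sum>t=1..n. oscillation \<eta> b m t \<omega>) + ((\<Sum>t=1..n. real (Y (int t) \<omega>) * remote t \<omega>) / c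
             + (\<Sum>t=1..n. remote t \<omega>)))"
          by (simp only: sum.distrib sum_subtractf sum_distrib_left sum_divide_distrib)
        also have "(\<Sum>t=1..n. real (Y (int t) \<omega>) * remote t \<omega>) / c \<le> (\<delta> / 36) * real n"
          using e(4) c_pos by (simp add: field_simps)
        also have "2 * (\<Sum>t=1..n. X t \<omega>) - (\<Sum>t=1..n. (sqrt (g t \<omega>) - sqrt (rate t \<omega>))\<^sup>2) / 2
           + (3 * (\<Sum>t=1..n. oscillation \<eta> b m t \<omega>) + (\<delta> / 36 * real n + (\<Sum>t=1..n. remote t \<omega>)))
          \<le> 2 * (\<delta> / 36 * real n) - \<delta> * real n / 2
            + (3 * (3 * \<eta> * real n) + (\<delta> / 36 * real n + \<delta> / 36 * real n))"
          using e(1,2,3,5) unfolding g_def by linarith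
        also have "\<dots> = - (5 / 36) * (\<delta> * real n)"
          by (simp add: \<eta>_def algebra_simps)
        also have "\<dots> < 0" using \<delta> e(6) by simp
        finally show "likelihood n \<theta> \<omega> < likelihood n \<theta>s \<omega>" by simp
      qed
    qed
  qed
  with \<epsilon> show ?thesis by blast
qed

text \<open>Finitely many neighbourhoods from \<open>likelihood_separation\<close> cover the compact
  set of parameters at distance at least \<open>r\<close> from \<open>\<theta>s\<close>. Their
  bounds hold simultaneously for all parameters inside, hence apply to an arbitrary random
  maximizer.\<close>

theorem likelihood_maximizer_consistent:
  fixes \<theta>hat :: "nat \<Rightarrow> 'w \<Rightarrow> 'p"
  assumes "compact \<Theta>"
    and ident: "\<And>\<theta>. \<theta> \<in> \<Theta> \<Longrightarrow> (AE \<omega> in M. f \<theta> (past Y 1 \<omega>) = f \<theta>s (past Y 1 \<omega>)) \<Longrightarrow> \<theta> = \<theta>s"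
    and max: "\<And>n \<omega>. 1 \<le> n \<Longrightarrow> \<omega> \<in> space M \<Longrightarrow> \<theta>hat n \<omega> \<in> \<Theta> \<and> likelihood n \<theta>s \<omega> \<le> likelihood n (\<theta>hat n \<omega>) \<omega>"
  shows "AE \<omega> in M. (\<lambda>n. \<theta>hat n \<omega>) \<longlonglongrightarrow> \<theta>s"
proof -
  have away: "AE \<omega> in M. \<forall>\<^sub>F n in sequentially. dist (\<theta>hat n \<omega>) \<theta>s < r" if r: "0 < r" for r
  proof -
    define C where "C = \<Theta> - ball \<theta>s r"
    have "compact C" unfolding C_def using \<open>compact \<Theta>\<close> by (intro compact_diff) auto
    have "\<exists>\<epsilon>>0. AE \<omega> in M. \<forall>\<^sub>F n in sequentially. \<forall>\<theta>\<in>\<Theta>. dist \<theta> \<theta>0 < \<epsilon> \<longrightarrow>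
        likelihood n \<theta> \<omega> < likelihood n \<theta>s \<omega>" if "\<theta>0 \<in> C" for \<theta>0
    proof (rule likelihood_separation)
      show "\<theta>0 \<in> \<Theta>" using that by (simp add: C_def)
      show "\<not> (AE \<omega> in M. f \<theta>0 (past Y 1 \<omega>) = f \<theta>s (past Y 1 \<omega>))"
        using ident[of \<theta>0] that r by (auto simp: C_def)
    qed
    then have "\<forall>\<theta>0\<in>C. \<exists>\<epsilon>. 0 < \<epsilon> \<and> (AE \<omega> in M. \<forall>\<^sub>F n in sequentially. \<forall>\<theta>\<in>\<Theta>. dist \<theta> \<theta>0 < \<epsilon> \<longrightarrow>
        likelihood n \<theta> \<omega> < likelihood n \<theta>s \<omega>)" by blast
    from bchoice[OF this] obtain e where e: "\<forall>\<theta>0\<in>C. 0 < e \<theta>0 \<and> (AE \<omega> in M. \<forall>\<^sub>F n in sequentially. \<forall>\<theta>\<in>\<Theta>. dist \<theta> \<theta>0 < e \<theta>0 \<longrightarrow>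
        likelihood n \<theta> \<omega> < likelihood n \<theta>s \<omega>)" ..
    have "C \<subseteq> (\<Union>\<theta>0\<in>C. ball \<theta>0 (e \<theta>0))" using e by auto
    then obtain D where D: "D \<subseteq> C" "finite D" "C \<subseteq> (\<Union>\<theta>0\<in>D. ball \<theta>0 (e \<theta>0))"
      using compactE_image[OF \<open>compact C\<close>, of C "\<lambda>\<theta>0. ball \<theta>0 (e \<theta>0)"] by auto
    have "AE \<omega> in M. \<forall>\<theta>0\<in>D. \<forall>\<^sub>F n in sequentially. \<forall>\<theta>\<in>\<Theta>. dist \<theta> \<theta>0 < e \<theta>0 \<longrightarrow>
        likelihood n \<theta> \<omega> < likelihood n \<theta>s \<omega>"
      using D(1,2) e by (intro AE_finite_allI) blast+
    then show ?thesis
      using AE_space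
    proof eventually_elim
      case (elim \<omega>)
      have "\<forall>\<^sub>F n in sequentially. \<forall>\<theta>0\<in>D. \<forall>\<theta>\<in>\<Theta>. dist \<theta> \<theta>0 < e \<theta>0 \<longrightarrow>
        likelihood n \<theta> \<omega> < likelihood n \<theta>s \<omega>"
        using elim(1) D(2) by (intro eventually_ball_finite) auto
      then show ?case using eventually_ge_at_top[of 1]
      proof eventually_elim
        case ev: (elim n)
        have m: "\<theta>hat n \<omega> \<in> \<Theta>" "likelihood n \<theta>s \<omega> \<le> likelihood n (\<theta>hat n \<omega>) \<omega>"
          using max[OF ev(2) elim(2)] by auto
        have "\<theta>hat n \<omega> \<notin> C"
        proof
          assume "\<theta>hat n \<omega> \<in> C"
          then obtain \<theta>0 where "\<theta>0 \<in> D" "dist (\<theta>hat n \<omega>) \<theta>0 < e \<theta>0"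
            using D(3) by (auto simp: dist_commute)
          then have "likelihood n (\<theta>hat n \<omega>) \<omega> < likelihood n \<theta>s \<omega>" using ev(1) m(1) by blast
          then show False using m(2) by simp
        qed
        then show ?case using m(1) by (auto simp: C_def dist_commute)
      qed
    qed
  qed
  \<comment> \<open>Countably many radii suffice for convergence, so the exceptional null sets can
    be combined.\<close>
  have "AE \<omega> in M. \<forall>j::nat. \<forall>\<^sub>F n in sequentially. dist (\<theta>hat n \<omega>) \<theta>s < inverse (real (Suc j))"
    unfolding AE_all_countable using away by simp
  then show ?thesis
  proof eventually_elim
    case (elim \<omega>)
    show ?case
    proof (rule tendstoI)
      fix r :: real assume "0 < r"
      then obtain j where j: "inverse (real (Suc j)) < r" using reals_Archimedean by blast
      show "\<forall>\<^sub>F n in sequentially. dist (\<theta>hat n \<omega>) \<theta>s < r"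
        using elim[rule_format, of j] by eventually_elim (use j in linarith)
    qed
  qed
qed

end

section \<open>From the stated assumptions to the locale\<close>

lemma sum_ennreal_le_real:
  assumes "\<And>k. 0 \<le> b k" "summable b" "ennreal \<bar>x\<bar> \<le> (\<Sum>k. ennreal (b k))"
  shows "\<bar>x\<bar> \<le> suminf b"
  using assms by (simp add: suminf_ennreal2 suminf_nonneg)

lemma l1_norm_real: "l1_norm (x::real) = \<bar>x\<bar>"
  by (simp add: l1_norm_def)

lemma sup_norm_ge: "\<theta> \<in> \<Theta> \<Longrightarrow> ennreal (l1_norm (g \<theta>)) \<le> sup_norm \<Theta> g"
  unfolding sup_norm_def by (rule SUP_upper)

lemma log_lik_sum:
  "log_lik f Y {1..int n} \<theta> \<omega> = (\<Sum>t=1..n. real (Y (int t) \<omega>) * ln (f \<theta> (observed_past Y (int t) \<omega>))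
      - f \<theta> (observed_past Y (int t) \<omega>))"
proof -
  have "{1..int n} = int ` {1..n}" by (simp add: image_int_atLeastAtMost)
  then show ?thesis by (simp add: log_lik_def sum.reindex)
qed

text \<open>The asymptotic bound holds beyond some \<open>N\<close>; adding the finitely many ratios
  up to \<open>N\<close> to the constant extends it to all lags from 1 on.\<close>

lemma bigo_powr_bound:
  assumes "\<alpha> \<in> O(\<lambda>j. real j powr - \<gamma>)" "\<And>k. 1 \<le> k \<Longrightarrow> 0 \<le> \<alpha> k"
  shows "\<exists>C\<ge>0. \<forall>k\<ge>1. \<alpha> k \<le> C * real k powr - \<gamma>"
proof -
  obtain c where c: "\<forall>\<^sub>F k in sequentially. norm (\<alpha> k) \<le> c * norm (real k powr - \<gamma>)"
    using landau_o.bigE[OF assms(1)] by blast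
  then obtain N where N: "\<And>k. N \<le> k \<Longrightarrow> \<bar>\<alpha> k\<bar> \<le> c * real k powr - \<gamma>"
    by (auto simp: eventually_sequentially)
  define C where "C = \<bar>c\<bar> + (\<Sum>k=1..N. \<alpha> k / real k powr - \<gamma>)"
  have nn: "0 \<le> (\<Sum>k=1..N. \<alpha> k / real k powr - \<gamma>)" by (intro sum_nonneg divide_nonneg_nonneg assms(2)) auto
  have "\<alpha> k \<le> C * real k powr - \<gamma>" if k: "1 \<le> k" for k
  proof (cases "k \<le> N")
    case True
    have "\<alpha> k / real k powr - \<gamma> \<le> (\<Sum>k=1..N. \<alpha> k / real k powr - \<gamma>)"
      using True k assms(2) by (intro member_le_sum) auto
    also have "\<dots> \<le> C" by (simp add: C_def)
    finally show ?thesis using k by (simp add: divide_le_eq)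
  next
    case False
    have "c \<le> C" using nn unfolding C_def by linarith
    then have "c * real k powr - \<gamma> \<le> C * real k powr - \<gamma>" by (intro mult_right_mono) auto
    then show ?thesis using N[of k] False by linarith
  qed
  moreover have "0 \<le> C" using nn by (simp add: C_def)
  ultimately show ?thesis by blast
qed

theorem theorem3p1:
  fixes \<Theta> :: "(real ^ 'd) set"
    and f :: "real ^ 'd \<Rightarrow> (nat \<Rightarrow> real) \<Rightarrow> real"
    and \<theta>star :: "real ^ 'd"
    and M :: "'w measure"
    and Y :: "int \<Rightarrow> 'w \<Rightarrow> nat"
    and \<alpha> :: "nat \<Rightarrow> real"
    and \<gamma> :: real
    and \<theta>hat :: "nat \<Rightarrow> 'w \<Rightarrow> real ^ 'd"
  assumes "compact \<Theta>"
    and "smooth_family \<Theta> f"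
    and "\<theta>star \<in> \<Theta>"
    and "prob_space M"
    and "poisson_autoregression M Y 0 (f \<theta>star)"
    and "\<theta>star \<in> interior \<Theta>"
    and "D_cond \<Theta> f"
    and "Id_cond M Y 0 \<Theta> f"
    and "A0 \<Theta> f \<alpha>"
    and "\<gamma> > 3 / 2"
    and "\<alpha> \<in> O(\<lambda>j. real j powr - \<gamma>)"
    and "\<And>r::nat. r \<ge> 1 \<Longrightarrow>
          \<exists>C>0. \<forall>t\<le>0. (\<integral>\<^sup>+ \<omega>. ennreal (real (Y t \<omega>) ^ r) \<partial>M) \<le> ennreal C"
    and "\<And>n. n \<ge> 1 \<Longrightarrow> is_mle M \<Theta> f Y {1..int n} (\<theta>hat n)"
  shows "AE \<omega> in M. (\<lambda>n. \<theta>hat n \<omega>) \<longlonglongrightarrow> \<theta>star"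
proof -
  obtain c where c: "0 < c" "\<And>y. y \<in> space seq_space \<Longrightarrow> c \<le> (INF \<theta>\<in>\<Theta>. f \<theta> y)"
    using assms(7) unfolding D_cond_def by blast
  have f0: "0 \<le> f \<theta> y" if "\<theta> \<in> \<Theta>" "y \<in> space seq_space" for \<theta> y
    using assms(2) that unfolding smooth_family_def by blast
  have cf: "c \<le> f \<theta> y" if "\<theta> \<in> \<Theta>" "y \<in> space seq_space" for \<theta> y
  proof -
    have "(INF \<theta>\<in>\<Theta>. f \<theta> y) \<le> f \<theta> y"
      using that f0 by (intro cINF_lower bdd_belowI2[where m=0]) auto
    then show ?thesis using c(2)[OF that(2)] by linarith
  qed
  have fm: "f \<theta> \<in> borel_measurable seq_space" if "\<theta> \<in> \<Theta>" for \<theta>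
    using assms(2) that unfolding smooth_family_def by blast
  have fc: "continuous_on \<Theta> (\<lambda>\<theta>. f \<theta> y)" if y: "y \<in> space seq_space" for y
  proof -
    have "C2_on (\<lambda>\<theta>. f \<theta> y) \<Theta>" using assms(2) y unfolding smooth_family_def by blast
    then obtain g' where "\<And>x. x \<in> \<Theta> \<Longrightarrow> ((\<lambda>\<theta>. f \<theta> y) has_derivative blinfun_apply (g' x)) (at x within \<Theta>)"
      unfolding C2_on_def by blast
    then show ?thesis by (rule has_derivative_continuous_on)
  qed
  have \<alpha>0: "0 \<le> \<alpha> k" if "1 \<le> k" for k using assms(9) that unfolding A0_def by blast
  have "sup_norm \<Theta> (\<lambda>\<theta>. f \<theta> zero_seq) < \<infinity>" using assms(9) unfolding A0_def by blast
  then obtain F where "0 \<le> F" and F: "sup_norm \<Theta> (\<lambda>\<theta>. f \<theta> zero_seq) = ennreal F"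
    by (cases "sup_norm \<Theta> (\<lambda>\<theta>. f \<theta> zero_seq)") auto
  have Ff: "f \<theta> zero_seq \<le> F" if "\<theta> \<in> \<Theta>" for \<theta>
    using sup_norm_ge[OF that, of "\<lambda>\<theta>. f \<theta> zero_seq"] \<open>0 \<le> F\<close> unfolding F l1_norm_real by simp
  have lip: "\<bar>f \<theta> y - f \<theta> y'\<bar> \<le> (\<Sum>k. \<alpha> (Suc k) * \<bar>y (Suc k) - y' (Suc k)\<bar>)"
    if "\<theta> \<in> \<Theta>" "y \<in> space seq_space" "y' \<in> space seq_space"
      "summable (\<lambda>k. \<alpha> (Suc k) * \<bar>y (Suc k) - y' (Suc k)\<bar>)" for \<theta> y y'
  proof (rule sum_ennreal_le_real[OF _ that(4)])
    have "ennreal \<bar>f \<theta> y - f \<theta> y'\<bar> \<le> sup_norm \<Theta> (\<lambda>\<theta>. f \<theta> y - f \<theta> y')"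
      using sup_norm_ge[OF that(1), of "\<lambda>\<theta>. f \<theta> y - f \<theta> y'"] unfolding l1_norm_real by simp
    also have "\<dots> \<le> (\<Sum>k. ennreal (\<alpha> (Suc k) * \<bar>y (Suc k) - y' (Suc k)\<bar>))"
      using assms(9) that(2,3) unfolding A0_def by blast
    finally show "ennreal \<bar>f \<theta> y - f \<theta> y'\<bar> \<le> (\<Sum>k. ennreal (\<alpha> (Suc k) * \<bar>y (Suc k) - y' (Suc k)\<bar>))" .
  qed (simp add: \<alpha>0)
  obtain C where C: "0 \<le> C" "\<And>k. 1 \<le> k \<Longrightarrow> \<alpha> k \<le> C * real k powr - \<gamma>"
    using bigo_powr_bound[OF assms(11) \<alpha>0] by blast
  \<comment> \<open>\<open>\<alpha>\<close> need not be monotone; this power majorant is decreasing,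
    and summable by the choice of \<open>\<gamma>\<close>.\<close>
  define \<beta> where "\<beta> k = C * real k powr - \<gamma>" for k :: nat
  have "summable (\<lambda>k. real k powr - \<gamma>)"
    using assms(10) by (subst summable_real_powr_iff) simp
  have \<alpha>1: "(\<Sum>k. \<alpha> (Suc k)) < 1" using assms(9) unfolding A0_def by blast
  have \<alpha>\<beta>: "\<alpha> k \<le> \<beta> k" if "1 \<le> k" for k using C(2)[OF that] by (simp add: \<beta>_def)
  have "summable \<beta>" using \<open>summable (\<lambda>k. real k powr - \<gamma>)\<close> unfolding \<beta>_def by (rule summable_mult)
  then have \<beta>s: "summable (\<lambda>k. \<beta> (Suc k))" by (simp only: summable_Suc_iff)
  obtain K where K: "\<And>t. t \<le> 0 \<Longrightarrow> (\<integral>\<^sup>+ \<omega>. ennreal (real (Y t \<omega>)) \<partial>M) \<le> ennreal K"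
    using assms(12)[of 1] by auto
  interpret P: poisson_family M Y f \<theta>star \<Theta> \<alpha> \<beta> c F K
  proof (intro poisson_family.intro poisson_process.intro poisson_process_axioms.intro poisson_family_axioms.intro)
    show "prob_space M" by fact
    show "Y t \<in> measurable M (count_space UNIV)" for t
      using assms(5) unfolding poisson_autoregression_def by blast
    show "(\<lambda>\<omega>. f \<theta>star (past Y t \<omega>)) \<in> borel_measurable (hist M Y (t - 1))" for t
      by (rule measurable_compose[OF past_measurable fm[OF assms(3)]])
    show "0 < f \<theta>star (past Y t \<omega>)" for t \<omega>
      using cf[OF assms(3) past_space, of Y t \<omega>] c(1) by linarith
    show "AE \<omega> in M. real_cond_exp M (hist M Y (t - 1)) (indicator (Y t -` {k} \<inter> space M)) \<omega>
        = pmf (poisson_pmf (f \<theta>star (past Y t \<omega>))) k" if "0 < t" for t k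
    proof -
      have "AE \<omega> in M. real_cond_exp M (hist M Y (t - 1)) (indicator (Y t -` {k} \<inter> space M)) \<omega>
          = measure_pmf.prob (poisson_pmf (f \<theta>star (past Y t \<omega>))) {k}"
        using assms(5) that unfolding poisson_autoregression_def by blast
      then show ?thesis by (simp only: measure_pmf_single)
    qed
    show "\<beta> j \<le> \<beta> i" if "1 \<le> i" "i \<le> j" for i j
      unfolding \<beta>_def using that C(1) assms(10) by (intro mult_left_mono powr_mono2') auto
  qed (use assms(3) fm fc c(1) cf Ff \<alpha>0 \<alpha>1 lip \<alpha>\<beta> \<beta>s K in auto)
  show ?thesis
  proof (rule P.likelihood_maximizer_consistent[OF assms(1)])
    fix \<theta> assume "\<theta> \<in> \<Theta>" "AE \<omega> in M. f \<theta> (past Y 1 \<omega>) = f \<theta>star (past Y 1 \<omega>)"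
    \<comment> \<open>Identifiability is applied at time 1, whose past lies entirely before the
      observations.\<close>
    then show "\<theta> = \<theta>star"
      using assms(3,8) unfolding Id_cond_def by (metis zero_less_one)
  next
    fix n :: nat and \<omega> assume n: "1 \<le> n" and \<omega>: "\<omega> \<in> space M"
    then show "\<theta>hat n \<omega> \<in> \<Theta> \<and> P.likelihood n \<theta>star \<omega> \<le> P.likelihood n (\<theta>hat n \<omega>) \<omega>"
      using assms(3) assms(13)[OF n]
      by (auto simp: is_mle_def is_arg_max_def log_lik_sum P.likelihood_def not_less)
  qed
qed

end
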